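(* Let $\mathcal U$ be a vector superspace and let $a(Z,W)$ be a local $\mathcal U$-valued formal distribution in the two sets of variables $Z,W$. Then $a(Z,W)$ can be uniquely decomposed as $$a(Z,W)=\sum_{(j|J):\,j\ge 0}\bigl(\partial_W^{(j|J)}\delta(Z,W)\bigr)\,c_{j|J}(W),$$ where the sum is finite and the $c_{j|J}(W)$ are $\mathcal U$-valued formal distributions in $W$. The coefficients are given by $$c_{j|J}(W)=\mathrm{res}_Z\,(Z-W)^{j|J}\,a(Z,W).$$
   Context: Ground field $\mathbb C$; $N\ge 0$ is a fixed integer. $Z=(z,\theta^1,\dots,\theta^N)$, $W=(w,\zeta^1,\dots,\zeta^N)$ with $z,w$ even and $\theta^i,\zeta^i$ odd variables, all supercommuting with one another (in particular all odd variables anticommute). For a subset $J=\{j_1<\dots<j_k\}\subset\{1,\dots,N\}$: $\theta^J=\theta^{j_1}\cdots\theta^{j_k}$, $Z^{j|J}=z^j\theta^J$, and $\theta^N=\theta^1\cdots\theta^N$. In exponents of $-1$ we write $J$ for $\#J$. A $\mathcal U$-valued formal distribution in $Z$ is a formal sum $\sum_{n\in\mathbb Z,I}Z^{n|I}a_{n|I}$ with arbitrary $a_{n|I}\in\mathcal U$ (and similarly, in two sets of variables, $\sum Z^{j|J}W^{k|K}a_{j|J,k|K}$); $\mathrm{res}_Z$ denotes the coefficient of $Z^{-1|N}=z^{-1}\theta^1\cdots\theta^N$, the coefficient being written to the right of $Z^{-1|N}$. A distribution $a(Z,W)$ is local if $(z-w)^n a(Z,W)=0$ for some integer $n\ge 0$.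 $(Z-W)^{j|J}=(z-w)^j\prod_{i\in J}(\theta^i-\zeta^i)$ (product in increasing order of $i$); $\partial_W^{j|J}=\partial_w^j\partial_{\zeta^{j_1}}\cdots\partial_{\zeta^{j_k}}$ and $\partial_W^{(j|J)}=\frac{(-1)^{J(J+1)/2}}{j!}\partial_W^{j|J}$. $\delta(Z,W)=(i_{z,w}-i_{w,z})\frac{(\theta^1-\zeta^1)\cdots(\theta^N-\zeta^N)}{z-w}$, where $i_{z,w}$ (resp. $i_{w,z}$) is expansion in the domain $|z|>|w|$ (resp. $|w|>|z|$). *)

theory Defs
  imports Complex_Main "HOL-Library.Function_Algebras"
begin

locale vector_superspace = vector_space scale
  for scale :: "complex \<Rightarrow> 'u::ab_group_add \<Rightarrow> 'u" +
  fixes U0 U1 :: "'u set"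
  assumes subspace_even: "subspace U0"
    and subspace_odd: "subspace U1"
    and inter_parts: "U0 \<inter> U1 = {0}"
    and sum_parts: "\<exists>u\<in>U0. \<exists>v\<in>U1. x = u + v"

(* A formal distribution is the family of its coefficients: a k K is the coefficient of
   W^(k|K), and a j J k K the coefficient of Z^(j|J) W^(k|K), with the odd variables
   indexed by 1..N. Coefficients stand to the right of the monomials, so their parity never
   enters a sign. Addition and zero are pointwise (Function_Algebras); the product is
   dist_mult below, not the pointwise one. *)
type_synonym 'a dist1 = "int \<Rightarrow> nat set \<Rightarrow> 'a"
type_synonym 'a dist2 = "int \<Rightarrow> nat set \<Rightarrow> int \<Rightarrow> nat set \<Rightarrow> 'a"

definition is_dist1 :: "nat \<Rightarrow> 'a::zero dist1 \<Rightarrow> bool" where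
  "is_dist1 N c \<longleftrightarrow> (\<forall>k K. c k K \<noteq> 0 \<longrightarrow> K \<subseteq> {1..N})"

definition is_dist2 :: "nat \<Rightarrow> 'a::zero dist2 \<Rightarrow> bool" where
  "is_dist2 N a \<longleftrightarrow> (\<forall>j J k K. a j J k K \<noteq> 0 \<longrightarrow> J \<subseteq> {1..N} \<and> K \<subseteq> {1..N})"

(* \<theta>^J \<theta>^L = odd_sign J L * \<theta>^(J \<union> L) for disjoint J and L *)
definition odd_sign :: "nat set \<Rightarrow> nat set \<Rightarrow> complex" where
  "odd_sign J L = (-1) ^ card {(j, l). j \<in> J \<and> l \<in> L \<and> l < j}"

(* \<theta>^J \<zeta>^K \<theta>^L \<zeta>^M = (-1)^(#K #L) \<theta>^J \<theta>^L \<zeta>^K \<zeta>^M *)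
definition mono_sign :: "nat set \<Rightarrow> nat set \<Rightarrow> nat set \<Rightarrow> nat set \<Rightarrow> complex" where
  "mono_sign J K L M = (-1) ^ (card K * card L) * odd_sign J L * odd_sign K M"

(* The Cauchy product of a scalar distribution with a U-valued one. It is only meaningful when
   each coefficient is a sum of finitely many nonzero terms, which holds wherever it is used:
   one factor is a Laurent polynomial, or f is supported on finitely many values of
   j' + k' and a does not involve z. *)
definition dist_mult ::
  "(complex \<Rightarrow> 'u::ab_group_add \<Rightarrow> 'u) \<Rightarrow> complex dist2 \<Rightarrow> 'u dist2 \<Rightarrow> 'u dist2" where
  "dist_mult scale f a = (\<lambda>j J k K.
     \<Sum>(j', J', k', K') \<in> {(j', J', k', K'). J' \<subseteq> J \<and> K' \<subseteq> K \<and>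
                              f j' J' k' K' \<noteq> 0 \<and> a (j - j') (J - J') (k - k') (K - K') \<noteq> 0}.
       scale (mono_sign J' K' (J - J') (K - K') * f j' J' k' K')
             (a (j - j') (J - J') (k - k') (K - K')))"

abbreviation cmult :: "complex dist2 \<Rightarrow> complex dist2 \<Rightarrow> complex dist2" where
  "cmult \<equiv> dist_mult (*)"

definition monomial :: "int \<Rightarrow> nat set \<Rightarrow> int \<Rightarrow> nat set \<Rightarrow> complex dist2" where
  "monomial j J k K = (\<lambda>j' J' k' K'. if j' = j \<and> J' = J \<and> k' = k \<and> K' = K then 1 else 0)"

definition even_diff_power :: "nat \<Rightarrow> complex dist2" where
  "even_diff_power n = (cmult (monomial 1 {} 0 {} - monomial 0 {} 1 {}) ^^ n) (monomial 0 {} 0 {})"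

definition odd_diff_prod :: "nat set \<Rightarrow> complex dist2" where
  "odd_diff_prod J = foldr (\<lambda>i. cmult (monomial 0 {i} 0 {} - monomial 0 {} 0 {i}))
     (sorted_list_of_set J) (monomial 0 {} 0 {})"

(* (Z - W)^(j|J) *)
definition diff_power :: "nat \<Rightarrow> nat set \<Rightarrow> complex dist2" where
  "diff_power j J = cmult (even_diff_power j) (odd_diff_prod J)"

definition local_dist :: "(complex \<Rightarrow> 'u::ab_group_add \<Rightarrow> 'u) \<Rightarrow> 'u dist2 \<Rightarrow> bool" where
  "local_dist scale a \<longleftrightarrow> (\<exists>n. dist_mult scale (even_diff_power n) a = 0)"

(* 1/(z - w) expanded for |z| > |w|: the sum of z^(-1-n) w^n over n \<ge> 0 *)
definition inv_diff_zw :: "complex dist2" where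
  "inv_diff_zw = (\<lambda>j J k K. if J = {} \<and> K = {} \<and> k \<ge> 0 \<and> j = - 1 - k then 1 else 0)"

(* 1/(z - w) expanded for |w| > |z|: minus the sum of z^n w^(-1-n) over n \<ge> 0 *)
definition inv_diff_wz :: "complex dist2" where
  "inv_diff_wz = (\<lambda>j J k K. if J = {} \<and> K = {} \<and> j \<ge> 0 \<and> k = - 1 - j then - 1 else 0)"

definition super_delta :: "nat \<Rightarrow> complex dist2" where
  "super_delta N = cmult inv_diff_zw (odd_diff_prod {1..N}) - cmult inv_diff_wz (odd_diff_prod {1..N})"

definition deriv_w :: "complex dist2 \<Rightarrow> complex dist2" where
  "deriv_w f = (\<lambda>j J k K. of_int (k + 1) * f j J (k + 1) K)"

(* The left derivative \<partial>/\<partial>\<zeta>^i; the sign comes from moving it past \<theta>^J and past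
   those \<zeta>^l with l < i. *)
definition deriv_zeta :: "nat \<Rightarrow> complex dist2 \<Rightarrow> complex dist2" where
  "deriv_zeta i f = (\<lambda>j J k K.
     if i \<in> K then 0 else (-1) ^ (card J + card {l \<in> K. l < i}) * f j J k (insert i K))"

definition deriv_W :: "nat \<Rightarrow> nat set \<Rightarrow> complex dist2 \<Rightarrow> complex dist2" where
  "deriv_W j J f = (deriv_w ^^ j) (foldr deriv_zeta (sorted_list_of_set J) f)"

definition divided_deriv_W :: "nat \<Rightarrow> nat set \<Rightarrow> complex dist2 \<Rightarrow> complex dist2" where
  "divided_deriv_W j J f = (\<lambda>i I k K.
     (-1) ^ (card J * (card J + 1) div 2) / fact j * deriv_W j J f i I k K)"

definition res_Z :: "nat \<Rightarrow> 'u dist2 \<Rightarrow> 'u dist1" where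
  "res_Z N a = a (- 1) {1..N}"

definition as_dist_W :: "'u::zero dist1 \<Rightarrow> 'u dist2" where
  "as_dist_W c = (\<lambda>j J k K. if j = 0 \<and> J = {} then c k K else 0)"

(* c is the coefficient family of a finite expansion of a in the (j|J)-derivatives of delta.
   The index J ranges over subsets of {1..N}, so c vanishes by convention at all other J. *)
definition delta_decomposition ::
  "(complex \<Rightarrow> 'u::ab_group_add \<Rightarrow> 'u) \<Rightarrow> nat \<Rightarrow> 'u dist2 \<Rightarrow> (nat \<Rightarrow> nat set \<Rightarrow> 'u dist1) \<Rightarrow> bool" where
  "delta_decomposition scale N a c \<longleftrightarrow>
     (\<forall>j J. is_dist1 N (c j J)) \<and>
     (\<forall>j J. \<not> J \<subseteq> {1..N} \<longrightarrow> c j J = 0) \<and>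
     finite {(j, J). c j J \<noteq> 0} \<and>
     a = (\<Sum>(j, J) \<in> {(j, J). c j J \<noteq> 0}.
            dist_mult scale (divided_deriv_W j J (super_delta N)) (as_dist_W (c j J)))"

end

(* Multiplication by z - w and by the theta^i - zeta^i are operators E and H_i on distributions.
   The H_i anticommute among themselves, and with the derivatives D_i in zeta^i they satisfy
   H_i D_i + D_i H_i = -1, while E D_w - D_w E = 1. As delta(Z,W) is annihilated by E and by every
   H_i, this Clifford/Weyl algebra shows that the residue of (Z-W)^(j|J) times the (m|J')-th divided
   derivative of delta is 1 if (j|J) = (m|J') and 0 otherwise, which gives the formula for the
   coefficients and uniqueness.
   For existence, subtract from a the expansion with these coefficients. The difference is local
   and all its residues vanish, so it is 0: by descending induction on the number of theta's, the
   residue against (Z-W)^(j|J) with J the complement of I isolates the coefficient of theta^I,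
   and a sequence killed by a power of E is determined by its residues against the (z-w)^j. *)
theory Submission
  imports Defs
begin

text \<open>\<open>dist_mult\<close> sums over a support set, and a sum over an infinite set is 0 by
  convention, so associativity cannot be used freely. What is proved is that a single z, w, theta^i
  or zeta^i can be moved out of the left factor. This suffices: (Z-W)^(j|J) and delta(Z,W) are words
  in E and the H_i applied to a distribution without odd variables, and derivatives act only on
  delta, never on a product. The commutation relations alone do not settle every residue of a
  derivative of delta. If J is a proper subset of J', no H_i is left over to annihilate delta;
  instead the number of odd variables, N - #J' + #J < N, is too small for theta^1...theta^N. If j <
  m, some D_w survives, but delta has degree -1 in z, w, so its z^(-1) part sits at w^0 and is
  killed by D_w. If J = J', moving the H_i past the D's produces exactly the sign (-1)^(#J(#J+1)/2)
  built into the divided derivative, and the two cancel. Rules that compare \<open>card J\<close>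
  with \<open>card (J - {i})\<close> fail for infinite \<open>J\<close>, where \<open>card\<close>
  is 0; this is why they assume \<open>is_dist2\<close>.\<close>

lemmas dist_apply = zero_fun_apply plus_fun_apply uminus_apply minus_apply

(* As simp rules, these would also rewrite eta-expanded distributions in induction steps, where
   equations between whole distributions are needed. *)
declare dist_apply [simp del]

section \<open>Signs, and multiplication by the variables as operators\<close>

text \<open>A sign that uses only negation, so that the operators below act on scalar and on
  \<open>'u\<close>-valued distributions alike.\<close>

definition sg :: "nat \<Rightarrow> 'a::ab_group_add \<Rightarrow> 'a" where
  "sg n x = (if even n then x else - x)"

text \<open>For \<open>i \<in> J\<close> its parity is the sign of sorting
  \<open>\<theta>^i \<theta>^(J - {i})\<close> into \<open>\<theta>^J\<close>.\<close>

definition below :: "nat \<Rightarrow> nat set \<Rightarrow> nat" where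
  "below i J = card {l \<in> J. l < i}"

definition mult_z :: "'a::ab_group_add dist2 \<Rightarrow> 'a dist2" where
  "mult_z a = (\<lambda>j J k K. a (j - 1) J k K)"

definition mult_w :: "'a::ab_group_add dist2 \<Rightarrow> 'a dist2" where
  "mult_w a = (\<lambda>j J k K. a j J (k - 1) K)"

definition mult_theta :: "nat \<Rightarrow> 'a::ab_group_add dist2 \<Rightarrow> 'a dist2" where
  "mult_theta i a = (\<lambda>j J k K. if i \<in> J then sg (below i J) (a j (J - {i}) k K) else 0)"

text \<open>\<open>card J\<close> is the cost of moving \<open>\<zeta>^i\<close> from the front past
  \<open>\<theta>^J\<close>.\<close>

definition mult_zeta :: "nat \<Rightarrow> 'a::ab_group_add dist2 \<Rightarrow> 'a dist2" where
  "mult_zeta i a = (\<lambda>j J k K. if i \<in> K then sg (card J + below i K) (a j J k (K - {i})) else 0)"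

definition mult_even :: "'a::ab_group_add dist2 \<Rightarrow> 'a dist2" where
  "mult_even a = mult_z a - mult_w a"

definition mult_odd :: "nat \<Rightarrow> 'a::ab_group_add dist2 \<Rightarrow> 'a dist2" where
  "mult_odd i a = mult_theta i a - mult_zeta i a"

text \<open>\<open>p\<close> is the total degree in z and w, \<open>q\<close> the number of odd
  variables; \<open>q\<close> is an integer so that derivatives lower it without truncation. Fixing
  \<open>p\<close> makes products with distributions in W finite, fixing \<open>q\<close> rules out
  residues by counting.\<close>

definition homogeneous :: "nat \<Rightarrow> int \<Rightarrow> int \<Rightarrow> 'a::zero dist2 \<Rightarrow> bool" where
  "homogeneous N p q f \<longleftrightarrow> (\<forall>j J k K. f j J k K \<noteq> 0 \<longrightarrow>
     J \<subseteq> {1..N} \<and> K \<subseteq> {1..N} \<and> j + k = p \<and> int (card J + card K) = q)"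

lemma sg_0 [simp]: "sg n 0 = 0"
  by (simp add: sg_def)

lemma sg_eq_0_iff [simp]: "sg n x = 0 \<longleftrightarrow> x = 0"
  by (simp add: sg_def)

lemma sg_minus: "sg n (- x) = - sg n x"
  by (simp add: sg_def)

lemma sg_diff: "sg n (x - y) = sg n x - sg n y"
  by (simp add: sg_def)

lemma sg_sum: "sg n (sum g S) = (\<Sum>x\<in>S. sg n (g x))"
  by (simp add: sg_def sum_negf)

lemma sg_sg: "sg m (sg n x) = sg (m + n) x"
  by (simp add: sg_def)

lemma sg_complex: "sg n (x::complex) = (-1) ^ n * x"
  by (simp add: sg_def)

lemma sg_apply: "sg n f x = sg n (f x)"
  by (simp add: dist_apply sg_def)

lemma below_Un:
  assumes "A \<inter> B = {}"
  shows "below i (A \<union> B) = below i A + below i B"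
proof -
  have "{l \<in> A \<union> B. l < i} = {l \<in> A. l < i} \<union> {l \<in> B. l < i}" by auto
  moreover have "finite {l \<in> A. l < i}" "finite {l \<in> B. l < i}" by auto
  ultimately show ?thesis using assms unfolding below_def by (simp add: card_Un_disjoint disjoint_iff)
qed

lemma below_insert: "l \<notin> A \<Longrightarrow> below i (insert l A) = below i A + (if l < i then 1 else 0)"
proof -
  assume "l \<notin> A"
  have "{x \<in> insert l A. x < i} = (if l < i then insert l {x \<in> A. x < i} else {x \<in> A. x < i})"
    by auto
  moreover have "finite {x \<in> A. x < i}" by auto
  ultimately show ?thesis using \<open>l \<notin> A\<close> unfolding below_def by simp
qed

lemma below_remove: "l \<in> A \<Longrightarrow> below i A = below i (A - {l}) + (if l < i then 1 else 0)"
  using below_insert[of l "A - {l}" i] by (simp add: insert_absorb)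

lemma even_below_remove: "l \<in> A \<Longrightarrow> even (below i (A - {l})) \<longleftrightarrow> (even (below i A) \<longleftrightarrow> \<not> l < i)"
  using below_remove[of l A i] by auto

lemma even_card_remove: "l \<in> A \<Longrightarrow> finite A \<Longrightarrow> even (card (A - {l})) \<longleftrightarrow> odd (card A)"
  by (metis card_Suc_Diff1 even_Suc)

lemma is_dist2_zero_iff:
  "is_dist2 N f \<longleftrightarrow> (\<forall>j J k K. \<not> (J \<subseteq> {1..N} \<and> K \<subseteq> {1..N}) \<longrightarrow> f j J k K = 0)"
  unfolding is_dist2_def by blast

text \<open>Disposes of infinite index sets in sign computations: there \<open>card\<close> is 0 and
  removing an element does not change its parity, but the coefficients vanish.\<close>

lemma is_dist2_eq_0_infinite:
  assumes "is_dist2 N f" "infinite J"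
  shows "f j J k K = 0" "f j (J - {i}) k K = 0"
proof -
  have "\<not> J \<subseteq> {1..N}" "\<not> J - {i} \<subseteq> {1..N}"
    using assms(2) by (metis finite_Diff2 finite_atLeastAtMost finite_subset finite.emptyI finite.insertI)+
  then show "f j J k K = 0" "f j (J - {i}) k K = 0"
    using assms(1) unfolding is_dist2_def by metis+
qed

lemma homogeneousD:
  assumes "homogeneous N p q f" "f j J k K \<noteq> 0"
  shows "J \<subseteq> {1..N}" "K \<subseteq> {1..N}" "j + k = p" "int (card J + card K) = q"
  using assms unfolding homogeneous_def by metis+

lemma homogeneous_is_dist2: "homogeneous N p q f \<Longrightarrow> is_dist2 N f"
  unfolding homogeneous_def is_dist2_def by metis

lemma mult_even_apply: "mult_even a j J k K = a (j - 1) J k K - a j J (k - 1) K"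
  by (simp add: dist_apply mult_even_def mult_z_def mult_w_def)

lemma mult_even_add: "mult_even (a + b) = mult_even a + mult_even b"
  by (intro ext) (simp add: dist_apply mult_even_apply)

lemma mult_odd_apply: "mult_odd i a j J k K =
    (if i \<in> J then sg (below i J) (a j (J - {i}) k K) else 0) -
    (if i \<in> K then sg (card J + below i K) (a j J k (K - {i})) else 0)"
  by (simp add: dist_apply mult_odd_def mult_theta_def mult_zeta_def)

lemma mult_theta_apply: "mult_theta i a j J k K =
    (if i \<in> J then sg (below i J) (a j (J - {i}) k K) else 0)"
  by (simp add: mult_theta_def)

lemma mult_zeta_apply: "mult_zeta i a j J k K =
    (if i \<in> K then sg (card J + below i K) (a j J k (K - {i})) else 0)"
  by (simp add: mult_zeta_def)

lemma mult_odd_add: "mult_odd i (a + b) = mult_odd i a + mult_odd i b"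
  by (intro ext) (simp add: dist_apply mult_odd_apply sg_def)

lemma mult_odd_minus: "mult_odd i (- a) = - mult_odd i a"
  by (intro ext) (simp add: dist_apply mult_odd_apply sg_def)

lemma mult_odd_0 [simp]: "mult_odd i 0 = 0"
  by (intro ext) (simp add: dist_apply mult_odd_apply)

lemma mult_even_0 [simp]: "mult_even 0 = 0"
  by (intro ext) (simp add: dist_apply mult_even_apply)

lemma mult_even_odd: "mult_even (mult_odd i a) = mult_odd i (mult_even a)"
  by (intro ext) (simp add: dist_apply mult_even_apply mult_odd_apply sg_diff)

lemma is_dist2_mult_even: "is_dist2 N a \<Longrightarrow> is_dist2 N (mult_even a)"
  by (simp add: is_dist2_zero_iff mult_even_apply)

lemma is_dist2_mult_odd:
  assumes "is_dist2 N a" and i: "i \<in> {1..N}"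
  shows "is_dist2 N (mult_odd i a)"
  unfolding is_dist2_zero_iff
proof (intro allI impI)
  fix j J k K assume n: "\<not> (J \<subseteq> {1..N} \<and> K \<subseteq> {1..N})"
  then have "\<not> (J - {i} \<subseteq> {1..N} \<and> K \<subseteq> {1..N})" "\<not> (J \<subseteq> {1..N} \<and> K - {i} \<subseteq> {1..N})"
    using i by blast+
  then show "mult_odd i a j J k K = 0"
    using assms unfolding is_dist2_zero_iff by (simp add: dist_apply mult_odd_apply)
qed

section \<open>Anticommutation of the odd multiplications\<close>

lemma sg_eq_minus_sg: "even m \<longleftrightarrow> odd n \<Longrightarrow> sg m x = - sg n x"
  by (auto simp: sg_def)

text \<open>For \<open>i \<noteq> l\<close> exactly one of the two indices counts the other one as
  lying below it, so the two orders differ by one transposition. For \<open>i = l\<close> both sides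
  vanish, since an index cannot be removed twice.\<close>

lemma mult_theta_anticommute: "mult_theta i (mult_theta l a) = - mult_theta l (mult_theta i a)"
proof (intro ext)
  fix j J k K
  show "mult_theta i (mult_theta l a) j J k K = (- mult_theta l (mult_theta i a)) j J k K"
  proof (cases "i \<in> J \<and> l \<in> J \<and> i \<noteq> l")
    case True
    have sw: "J - {l} - {i} = J - {i} - {l}" by blast
    have "sg (below i J + below l (J - {i})) (a j (J - {i} - {l}) k K) =
        - sg (below l J + below i (J - {l})) (a j (J - {i} - {l}) k K)"
      using True by (intro sg_eq_minus_sg) (cases "i < l"; cases "even (below i J)"; simp add: even_below_remove)
    then show ?thesis using True by (simp add: mult_theta_def dist_apply sg_sg sw)
  qed (auto simp: mult_theta_def dist_apply)
qed

lemma mult_zeta_anticommute: "mult_zeta i (mult_zeta l a) = - mult_zeta l (mult_zeta i a)"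
proof (intro ext)
  fix j J k K
  show "mult_zeta i (mult_zeta l a) j J k K = (- mult_zeta l (mult_zeta i a)) j J k K"
  proof (cases "i \<in> K \<and> l \<in> K \<and> i \<noteq> l")
    case True
    have sw: "K - {l} - {i} = K - {i} - {l}" by blast
    have "sg (card J + below i K + (card J + below l (K - {i}))) (a j J k (K - {i} - {l})) =
        - sg (card J + below l K + (card J + below i (K - {l}))) (a j J k (K - {i} - {l}))"
      using True
      by (intro sg_eq_minus_sg) (cases "i < l"; cases "even (card J)"; cases "even (below i K)"; simp add: even_below_remove)
    then show ?thesis using True by (simp add: mult_zeta_def dist_apply sg_sg sw)
  qed (auto simp: mult_zeta_def dist_apply)
qed

text \<open>The sign comes from \<open>card\<close> alone: \<open>\<zeta>^l\<close> passes one theta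
  fewer when it is applied before \<open>\<theta>^i\<close>.\<close>

lemma mult_theta_zeta_anticommute:
  assumes "is_dist2 N a"
  shows "mult_theta i (mult_zeta l a) = - mult_zeta l (mult_theta i a)"
proof (intro ext)
  fix j J k K
  show "mult_theta i (mult_zeta l a) j J k K = (- mult_zeta l (mult_theta i a)) j J k K"
  proof (cases "i \<in> J \<and> l \<in> K")
    case True
    have "sg (below i J + (card (J - {i}) + below l K)) (a j (J - {i}) k (K - {l})) =
        - sg (card J + below l K + below i J) (a j (J - {i}) k (K - {l}))"
    proof (cases "finite J")
      case fin: True
      show ?thesis
        by (rule sg_eq_minus_sg)
          (use True fin in \<open>cases "even (card J)"; cases "even (below i J)"; simp add: even_card_remove del: card_Diff_singleton card_Diff_insert\<close>)
    next
      case False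
      then have "a j (J - {i}) k (K - {l}) = 0" using assms by (simp add: is_dist2_eq_0_infinite)
      then show ?thesis by simp
    qed
    then show ?thesis using True
      by (simp add: mult_zeta_def mult_theta_def dist_apply sg_sg del: card_Diff_singleton card_Diff_insert)
  qed (auto simp: mult_zeta_def mult_theta_def dist_apply)
qed

lemma mult_theta_diff: "mult_theta i (a - b) = mult_theta i a - mult_theta i b"
  by (intro ext) (simp add: dist_apply mult_theta_def sg_diff)

lemma mult_zeta_diff: "mult_zeta i (a - b) = mult_zeta i a - mult_zeta i b"
  by (intro ext) (simp add: dist_apply mult_zeta_def sg_diff)

lemma mult_odd_anticommute:
  assumes "is_dist2 N a"
  shows "mult_odd i (mult_odd l a) = - mult_odd l (mult_odd i a)"
  unfolding mult_odd_def mult_theta_diff mult_zeta_diff mult_theta_anticommute[of i l]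
    mult_zeta_anticommute[of i l] mult_theta_zeta_anticommute[OF assms] by simp

section \<open>Derivatives and their relations with the multiplications\<close>

lemma even_below_insert: "l \<notin> A \<Longrightarrow> even (below i (insert l A)) \<longleftrightarrow> (even (below i A) \<longleftrightarrow> \<not> l < i)"
  using below_insert[of l A i] by auto

lemma deriv_zeta_apply: "deriv_zeta i f j J k K =
    (if i \<in> K then 0 else sg (card J + below i K) (f j J k (insert i K)))"
  by (simp add: deriv_zeta_def sg_complex below_def)

lemma deriv_w_apply: "deriv_w f j J k K = of_int (k + 1) * f j J (k + 1) K"
  by (simp add: deriv_w_def)

lemma deriv_zeta_minus: "deriv_zeta i (- f) = - deriv_zeta i f"
  by (intro ext) (simp add: dist_apply deriv_zeta_apply sg_minus)

lemma deriv_zeta_0 [simp]: "deriv_zeta i 0 = 0"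
  by (intro ext) (simp add: dist_apply deriv_zeta_apply)

lemma deriv_w_0 [simp]: "deriv_w 0 = 0"
  by (intro ext) (simp add: dist_apply deriv_w_apply)

lemma is_dist2_deriv_zeta: "is_dist2 N f \<Longrightarrow> is_dist2 N (deriv_zeta i f)"
  by (simp add: is_dist2_zero_iff deriv_zeta_apply)

lemma deriv_zeta_mult_theta:
  assumes "is_dist2 N f"
  shows "deriv_zeta i (mult_theta l f) = - mult_theta l (deriv_zeta i f)"
proof (intro ext)
  fix j J k K
  show "deriv_zeta i (mult_theta l f) j J k K = (- mult_theta l (deriv_zeta i f)) j J k K"
  proof (cases "l \<in> J \<and> i \<notin> K")
    case True
    have "sg (card J + below i K + below l J) (f j (J - {l}) k (insert i K)) =
        - sg (below l J + (card (J - {l}) + below i K)) (f j (J - {l}) k (insert i K))"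
    proof (cases "finite J")
      case fin: True
      show ?thesis
        by (rule sg_eq_minus_sg)
          (use True fin in \<open>cases "even (card J)"; cases "even (below i K)"; simp add: even_card_remove del: card_Diff_singleton card_Diff_insert\<close>)
    next
      case False
      then have "f j (J - {l}) k (insert i K) = 0" using assms by (simp add: is_dist2_eq_0_infinite)
      then show ?thesis by simp
    qed
    then show ?thesis using True
      by (simp add: deriv_zeta_apply mult_theta_def dist_apply sg_sg del: card_Diff_singleton card_Diff_insert)
  qed (auto simp: deriv_zeta_apply mult_theta_def dist_apply)
qed

lemma deriv_zeta_mult_zeta_neq:
  assumes neq: "i \<noteq> l"
  shows "deriv_zeta i (mult_zeta l f) = - mult_zeta l (deriv_zeta i f)"
proof (intro ext)
  fix j J k K
  show "deriv_zeta i (mult_zeta l f) j J k K = (- mult_zeta l (deriv_zeta i f)) j J k K"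
  proof (cases "l \<in> K \<and> i \<notin> K")
    case True
    have sw: "insert i K - {l} = insert i (K - {l})" using neq by blast
    have "sg (card J + below i K + (card J + below l (insert i K))) (f j J k (insert i (K - {l}))) =
        - sg (card J + below l K + (card J + below i (K - {l}))) (f j J k (insert i (K - {l})))"
      using True neq
      by (intro sg_eq_minus_sg) (cases "i < l"; cases "even (card J)"; cases "even (below i K)"; simp add: even_below_remove even_below_insert)
    then show ?thesis using True by (simp add: deriv_zeta_apply mult_zeta_def dist_apply sg_sg sw)
  qed (use neq in \<open>auto simp: deriv_zeta_apply mult_zeta_def dist_apply\<close>)
qed

text \<open>At each \<open>K\<close> only one order contributes, \<open>deriv_zeta\<close> after
  \<open>mult_zeta\<close> if \<open>i \<notin> K\<close> and the reverse if
  \<open>i \<in> K\<close>; the same sign then occurs twice and cancels.\<close>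

lemma deriv_zeta_mult_zeta_same: "deriv_zeta i (mult_zeta i f) = f - mult_zeta i (deriv_zeta i f)"
proof (intro ext)
  fix j J k K
  have "even (below i (insert i K)) \<longleftrightarrow> even (below i K)" "even (below i (K - {i})) \<longleftrightarrow> even (below i K)"
    by (cases "i \<in> K"; simp add: insert_absorb even_below_remove even_below_insert)+
  then show "deriv_zeta i (mult_zeta i f) j J k K = (f - mult_zeta i (deriv_zeta i f)) j J k K"
    by (cases "i \<in> K") (simp_all add: deriv_zeta_apply mult_zeta_def dist_apply sg_def insert_absorb)
qed

lemma deriv_zeta_diff: "deriv_zeta i (f - g) = deriv_zeta i f - deriv_zeta i g"
  by (intro ext) (simp add: dist_apply deriv_zeta_apply sg_diff)

lemma deriv_zeta_mult_odd_neq: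
  assumes "is_dist2 N f" and neq: "i \<noteq> l"
  shows "deriv_zeta i (mult_odd l f) = - mult_odd l (deriv_zeta i f)"
  by (simp add: mult_odd_def deriv_zeta_diff deriv_zeta_mult_theta[OF assms(1)]
      deriv_zeta_mult_zeta_neq[OF neq])

lemma deriv_zeta_mult_odd_same:
  assumes "is_dist2 N f"
  shows "mult_odd i (deriv_zeta i f) = - f - deriv_zeta i (mult_odd i f)"
  by (simp add: mult_odd_def deriv_zeta_diff deriv_zeta_mult_theta[OF assms(1)]
      deriv_zeta_mult_zeta_same)

lemma mult_even_deriv_zeta: "mult_even (deriv_zeta i f) = deriv_zeta i (mult_even f)"
  by (intro ext) (simp add: dist_apply mult_even_apply deriv_zeta_apply sg_diff)

lemma deriv_w_mult_odd: "deriv_w (mult_odd i f) = mult_odd i (deriv_w f)"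
  by (intro ext) (simp add: dist_apply mult_odd_apply deriv_w_apply sg_def algebra_simps)

text \<open>Only the \<open>mult_w\<close> part fails to commute with \<open>deriv_w\<close>, and
  its minus sign in z - w makes the commutator \<open>+ f\<close>.\<close>

lemma mult_even_deriv_w: "mult_even (deriv_w f) = deriv_w (mult_even f) + f"
  by (intro ext) (simp add: dist_apply mult_even_apply deriv_w_apply algebra_simps)

section \<open>Effect of the operators on degrees\<close>

lemma homogeneous_mult_even:
  assumes "homogeneous N p q f" shows "homogeneous N (p + 1) q (mult_even f)"
  unfolding homogeneous_def
proof (intro allI impI)
  fix j J k K assume "mult_even f j J k K \<noteq> 0"
  then have "f (j - 1) J k K \<noteq> 0 \<or> f j J (k - 1) K \<noteq> 0" by (auto simp: mult_even_apply)
  then show "J \<subseteq> {1..N} \<and> K \<subseteq> {1..N} \<and> j + k = p + 1 \<and> int (card J + card K) = q"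
    using homogeneousD[OF assms, of "j - 1" J k K] homogeneousD[OF assms, of j J "k - 1" K] by auto
qed

lemma homogeneous_deriv_w:
  assumes "homogeneous N p q f" shows "homogeneous N (p - 1) q (deriv_w f)"
  unfolding homogeneous_def
proof (intro allI impI)
  fix j J k K assume "deriv_w f j J k K \<noteq> 0"
  then have "f j J (k + 1) K \<noteq> 0" by (auto simp: deriv_w_apply)
  then show "J \<subseteq> {1..N} \<and> K \<subseteq> {1..N} \<and> j + k = p - 1 \<and> int (card J + card K) = q"
    using homogeneousD[OF assms, of j J "k + 1" K] by auto
qed

lemma homogeneous_mult_odd:
  assumes h: "homogeneous N p q f" and i: "i \<in> {1..N}"
  shows "homogeneous N p (q + 1) (mult_odd i f)"
  unfolding homogeneous_def
proof (intro allI impI)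
  fix j J k K assume nz: "mult_odd i f j J k K \<noteq> 0"
  have "i \<in> J \<and> f j (J - {i}) k K \<noteq> 0 \<or> i \<in> K \<and> f j J k (K - {i}) \<noteq> 0"
  proof (rule ccontr)
    assume "\<not> ?thesis"
    then have "mult_odd i f j J k K = 0" by (auto simp: mult_odd_apply)
    with nz show False ..
  qed
  then consider "i \<in> J" "f j (J - {i}) k K \<noteq> 0" | "i \<in> K" "f j J k (K - {i}) \<noteq> 0"
    by argo
  then show "J \<subseteq> {1..N} \<and> K \<subseteq> {1..N} \<and> j + k = p \<and> int (card J + card K) = q + 1"
  proof cases
    case 1
    note * = homogeneousD[OF h 1(2)]
    then have "finite J" by (metis finite_Diff2 finite_atLeastAtMost finite_subset finite.emptyI finite.insertI)
    then have "card J = Suc (card (J - {i}))" using 1(1) by (simp only: card_Suc_Diff1)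
    moreover have "J \<subseteq> {1..N}" using *(1) i by blast
    ultimately show ?thesis using * by (simp del: card_Diff_singleton card_Diff_insert)
  next
    case 2
    note * = homogeneousD[OF h 2(2)]
    then have "finite K" by (metis finite_Diff2 finite_atLeastAtMost finite_subset finite.emptyI finite.insertI)
    then have "card K = Suc (card (K - {i}))" using 2(1) by (simp only: card_Suc_Diff1)
    moreover have "K \<subseteq> {1..N}" using *(2) i by blast
    ultimately show ?thesis using * by (simp del: card_Diff_singleton card_Diff_insert)
  qed
qed

lemma homogeneous_deriv_zeta:
  assumes h: "homogeneous N p q f"
  shows "homogeneous N p (q - 1) (deriv_zeta i f)"
  unfolding homogeneous_def
proof (intro allI impI)
  fix j J k K assume "deriv_zeta i f j J k K \<noteq> 0"
  then have 1: "i \<notin> K" "f j J k (insert i K) \<noteq> 0"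
    unfolding deriv_zeta_apply by (metis sg_0)+
  then have *: "J \<subseteq> {1..N}" "insert i K \<subseteq> {1..N}" "j + k = p" "int (card J + card (insert i K)) = q"
      using homogeneousD[OF h 1(2)] by auto
  moreover have "finite K" using * by (meson finite_insert finite_atLeastAtMost finite_subset)
  ultimately show "J \<subseteq> {1..N} \<and> K \<subseteq> {1..N} \<and> j + k = p \<and> int (card J + card K) = q - 1"
    using 1 by auto
qed

section \<open>Iterated operators\<close>

text \<open>\<open>foldr\<close> applies the head outermost, so on a sorted list this is left
  multiplication by the product in increasing order.\<close>

abbreviation mult_odds :: "nat list \<Rightarrow> 'a::ab_group_add dist2 \<Rightarrow> 'a dist2" where
  "mult_odds xs f \<equiv> foldr mult_odd xs f"

abbreviation deriv_zetas :: "nat list \<Rightarrow> complex dist2 \<Rightarrow> complex dist2" where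
  "deriv_zetas xs f \<equiv> foldr deriv_zeta xs f"

lemma deriv_zetas_minus: "deriv_zetas xs (- f) = - deriv_zetas xs f"
  by (induction xs) (auto simp: deriv_zeta_minus)

lemma mult_odds_0: "mult_odds xs 0 = 0"
  by (induction xs) auto

lemma deriv_zetas_0: "deriv_zetas xs 0 = 0"
  by (induction xs) auto

lemma mult_odds_add: "mult_odds xs (a + b) = mult_odds xs a + mult_odds xs b"
  by (induction xs) (auto simp: mult_odd_add)

lemma mult_odd_sg: "mult_odd i (sg n f) = sg n (mult_odd i f)"
  by (simp add: sg_def mult_odd_minus)

lemma mult_odds_sg: "mult_odds xs (sg n f) = sg n (mult_odds xs f)"
  by (induction xs) (auto simp: mult_odd_sg)

lemma mult_even_odds: "mult_even (mult_odds xs f) = mult_odds xs (mult_even f)"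
  by (induction xs) (auto simp: mult_even_odd)

lemma mult_evens_odds: "(mult_even ^^ n) (mult_odds xs f) = mult_odds xs ((mult_even ^^ n) f)"
  by (induction n) (auto simp: mult_even_odds)

lemma mult_evens_0: "(mult_even ^^ n) 0 = 0"
  by (induction n) auto

lemma mult_evens_add: "(mult_even ^^ n) (a + b) = (mult_even ^^ n) a + (mult_even ^^ n) b"
  by (induction n) (auto simp: mult_even_add)

lemma mult_even_deriv_zetas: "mult_even (deriv_zetas xs f) = deriv_zetas xs (mult_even f)"
  by (induction xs) (auto simp: mult_even_deriv_zeta)

lemma deriv_w_mult_odds: "deriv_w (mult_odds xs f) = mult_odds xs (deriv_w f)"
  by (induction xs) (auto simp: deriv_w_mult_odd)

lemma deriv_ws_mult_odds: "(deriv_w ^^ m) (mult_odds xs f) = mult_odds xs ((deriv_w ^^ m) f)"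
  by (induction m) (auto simp: deriv_w_mult_odds)

lemma is_dist2_mult_odds: "is_dist2 N f \<Longrightarrow> set xs \<subseteq> {1..N} \<Longrightarrow> is_dist2 N (mult_odds xs f)"
  by (induction xs) (auto intro!: is_dist2_mult_odd)

lemma is_dist2_deriv_zetas: "is_dist2 N f \<Longrightarrow> is_dist2 N (deriv_zetas xs f)"
  by (induction xs) (auto intro!: is_dist2_deriv_zeta)

lemma is_dist2_mult_evens: "is_dist2 N f \<Longrightarrow> is_dist2 N ((mult_even ^^ n) f)"
  by (induction n) (auto intro!: is_dist2_mult_even)

lemma homogeneous_mult_evens: "homogeneous N p q f \<Longrightarrow> homogeneous N (p + int n) q ((mult_even ^^ n) f)"
proof (induction n)
  case (Suc n)
  from homogeneous_mult_even[OF Suc.IH[OF Suc.prems]] show ?case by (simp add: algebra_simps)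
qed simp

lemma homogeneous_deriv_ws: "homogeneous N p q f \<Longrightarrow> homogeneous N (p - int n) q ((deriv_w ^^ n) f)"
proof (induction n)
  case (Suc n)
  from homogeneous_deriv_w[OF Suc.IH[OF Suc.prems]] show ?case by (simp add: algebra_simps)
qed simp

lemma homogeneous_mult_odds: "homogeneous N p q f \<Longrightarrow> set xs \<subseteq> {1..N} \<Longrightarrow>
   homogeneous N p (q + int (length xs)) (mult_odds xs f)"
proof (induction xs)
  case (Cons x xs)
  then have "homogeneous N p (q + int (length xs)) (mult_odds xs f)" by simp
  from homogeneous_mult_odd[OF this, of x] Cons.prems show ?case by (simp add: algebra_simps)
qed simp

lemma homogeneous_deriv_zetas: "homogeneous N p q f \<Longrightarrow>
   homogeneous N p (q - int (length xs)) (deriv_zetas xs f)"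
proof (induction xs)
  case (Cons x xs)
  then have "homogeneous N p (q - int (length xs)) (deriv_zetas xs f)" by simp
  from homogeneous_deriv_zeta[OF this, of x] Cons.prems show ?case by (simp add: algebra_simps)
qed simp

lemma mult_odd_mult_odds:
  assumes "is_dist2 N f" "set xs \<subseteq> {1..N}"
  shows "mult_odd i (mult_odds xs f) = sg (length xs) (mult_odds xs (mult_odd i f))"
  using assms(2)
proof (induction xs)
  case (Cons x xs)
  then have "is_dist2 N (mult_odds xs f)" using assms(1) by (intro is_dist2_mult_odds) auto
  then have "mult_odd i (mult_odds (x # xs) f) = - mult_odd x (mult_odd i (mult_odds xs f))"
    using mult_odd_anticommute[of N "mult_odds xs f" i x] by simp
  also have "\<dots> = - mult_odd x (sg (length xs) (mult_odds xs (mult_odd i f)))"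
    using Cons by simp
  finally show ?case by (simp add: sg_def mult_odd_minus)
qed (simp add: sg_def)

lemma mult_odd_deriv_zetas:
  assumes "is_dist2 N f" "i \<notin> set xs"
  shows "mult_odd i (deriv_zetas xs f) = sg (length xs) (deriv_zetas xs (mult_odd i f))"
  using assms(2)
proof (induction xs)
  case (Cons x xs)
  have "is_dist2 N (deriv_zetas xs f)" using assms(1) by (rule is_dist2_deriv_zetas)
  then have "mult_odd i (deriv_zetas (x # xs) f) = - deriv_zeta x (mult_odd i (deriv_zetas xs f))"
    using Cons.prems by (subst deriv_zeta_mult_odd_neq) auto
  also have "\<dots> = - deriv_zeta x (sg (length xs) (deriv_zetas xs (mult_odd i f)))"
    using Cons by simp
  finally show ?case by (simp add: sg_def deriv_zeta_minus)
qed (simp add: sg_def)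

text \<open>Anticommuting the operator with itself gives x = -x, which forces x = 0 for complex
  coefficients; an arbitrary abelian group may have 2-torsion.\<close>

lemma mult_odd_square:
  fixes f :: "complex dist2"
  assumes "is_dist2 N f"
  shows "mult_odd i (mult_odd i f) = 0"
proof (intro ext)
  fix j J k K
  have "mult_odd i (mult_odd i f) j J k K = (- mult_odd i (mult_odd i f)) j J k K"
    by (rule arg_cong[where f = "\<lambda>g. g j J k K"]) (rule mult_odd_anticommute[OF assms])
  then show "mult_odd i (mult_odd i f) j J k K = 0 j J k K" by (simp add: dist_apply)
qed

lemma mult_odd_mult_odds_eq_0:
  fixes f :: "complex dist2"
  assumes "is_dist2 N f" "set xs \<subseteq> {1..N}" "i \<in> set xs"
  shows "mult_odd i (mult_odds xs f) = 0"
  using assms(2,3)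
proof (induction xs)
  case (Cons x xs)
  then have d: "is_dist2 N (mult_odds xs f)" using assms(1) by (intro is_dist2_mult_odds) auto
  show ?case
  proof (cases "i = x")
    case True
    then show ?thesis using mult_odd_square[OF d] by simp
  next
    case False
    then have "mult_odd i (mult_odds xs f) = 0" using Cons by simp
    then show ?thesis using mult_odd_anticommute[OF d, of i x] by simp
  qed
qed simp

text \<open>The factor with index \<open>i\<close> anticommutes past those on its right until it
  reaches \<open>f\<close>.\<close>

lemma mult_odds_eq_0:
  assumes "is_dist2 N f" "set xs \<subseteq> {1..N}" "i \<in> set xs" "mult_odd i f = 0"
  shows "mult_odds xs f = 0"
  using assms(2,3)
proof (induction xs)
  case (Cons x xs)
  show ?case
  proof (cases "i = x")
    case True
    then show ?thesis using mult_odd_mult_odds[OF assms(1), of xs x] Cons.prems assms(4)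
      by (simp add: mult_odds_0)
  next
    case False
    then show ?thesis using Cons by simp
  qed
qed simp

text \<open>Origin of the normalising sign of the divided derivatives: with n indices in
  \<open>xs\<close>, the innermost H_x passes n derivatives and then contributes -1 from H_x D_x v =
  -v, so step n adds n + 1 to the exponent and the total is a triangular number.\<close>

lemma mult_odds_deriv_zetas_same:
  assumes v: "is_dist2 N v" and xs: "distinct xs" "\<forall>x\<in>set xs. mult_odd x v = 0"
  shows "mult_odds xs (deriv_zetas xs v) = sg (length xs * (length xs + 1) div 2) v"
  using xs
proof (induction xs rule: rev_induct)
  case (snoc x xs)
  have "mult_odd x (deriv_zeta x v) = - v"
    using snoc.prems by (simp add: deriv_zeta_mult_odd_same[OF v])
  then have "mult_odd x (deriv_zetas xs (deriv_zeta x v)) = sg (length xs + 1) (deriv_zetas xs v)"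
    using snoc.prems mult_odd_deriv_zetas[OF is_dist2_deriv_zeta[OF v], of x xs x]
    by (simp add: sg_def deriv_zetas_minus)
  then have "mult_odds (xs @ [x]) (deriv_zetas (xs @ [x]) v)
      = sg (length xs + 1 + length xs * (length xs + 1) div 2) v"
    using snoc by (simp add: mult_odds_sg sg_sg)
  moreover have "length (xs @ [x]) * (length (xs @ [x]) + 1)
      = length xs * (length xs + 1) + (length xs + 1) * 2"
    by (simp add: algebra_simps)
  then have "length xs + 1 + length xs * (length xs + 1) div 2
      = length (xs @ [x]) * (length (xs @ [x]) + 1) div 2"
    by (simp only: div_mult_self1 add.commute)
  ultimately show ?case by (simp only:)
qed (simp add: sg_def)

section \<open>The Cauchy product and its compatibility with the operators\<close>

definition conv_index :: "complex dist2 \<Rightarrow> 'u::zero dist2 \<Rightarrow> int \<Rightarrow> nat set \<Rightarrow> int \<Rightarrow> nat set \<Rightarrow>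
    (int \<times> nat set \<times> int \<times> nat set) set" where
  "conv_index f a j J k K = {(j', J', k', K'). J' \<subseteq> J \<and> K' \<subseteq> K \<and>
     f j' J' k' K' \<noteq> 0 \<and> a (j - j') (J - J') (k - k') (K - K') \<noteq> 0}"

text \<open>\<open>sum\<close> over an infinite set is 0, so laws such as additivity of
  \<open>dist_mult\<close> are available only where these supports are finite.\<close>

definition convolvable :: "complex dist2 \<Rightarrow> 'u::zero dist2 \<Rightarrow> bool" where
  "convolvable f a \<longleftrightarrow> (\<forall>j J k K. finite (conv_index f a j J k K))"

lemma odd_sign_empty [simp]: "odd_sign {} L = 1" "odd_sign J {} = 1"
  by (simp_all add: odd_sign_def)

text \<open>The inversions \<open>(i, l)\<close> of the new index are disjoint from those of
  \<open>J\<close>.\<close>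

lemma odd_sign_insert:
  assumes "finite J" "i \<notin> J"
  shows "odd_sign (insert i J) L = (-1) ^ below i L * odd_sign J L"
proof -
  let ?A = "Pair i ` {l \<in> L. l < i}" and ?B = "{(j, l). j \<in> J \<and> l \<in> L \<and> l < j}"
  have "{(j, l). j \<in> insert i J \<and> l \<in> L \<and> l < j} = ?A \<union> ?B" by auto
  moreover have "finite ?A" by simp
  moreover have "finite ?B"
    by (rule finite_subset[of _ "SIGMA j:J. {..<j}"]) (use assms in auto)
  moreover have "?A \<inter> ?B = {}" using assms by auto
  moreover have "card ?A = below i L" by (simp add: below_def card_image inj_on_def)
  ultimately show ?thesis by (simp add: odd_sign_def card_Un_disjoint power_add)
qed

lemma odd_sign_singleton: "odd_sign {i} L = (-1) ^ below i L"
  using odd_sign_insert[of "{}" i L] by simp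

text \<open>The first summand is the sign of inserting \<open>i\<close> inside the left factor, the
  second its contribution to \<open>odd_sign\<close> against the right factor. Together they are the
  sign of inserting \<open>i\<close> into the whole product.\<close>

lemma below_split:
  assumes "J' \<subseteq> J - {i}"
  shows "below i J = below i J' + below i (J - {i} - J')"
proof -
  have "below i J = below i (J - {i})" by (cases "i \<in> J") (simp_all add: below_remove)
  also have "J - {i} = J' \<union> (J - {i} - J')" using assms by blast
  also have "below i \<dots> = below i J' + below i (J - {i} - J')" by (rule below_Un) blast
  finally show ?thesis .
qed

lemma is_dist2_finite:
  assumes "is_dist2 N f" "f j J k K \<noteq> 0"
  shows "finite J" "finite K"
  using assms finite_subset[OF _ finite_atLeastAtMost] unfolding is_dist2_def by metis+

lemma conv_index_mult_z: "conv_index (mult_z f) a j J k K =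
    (\<lambda>(j', J', k', K'). (j' + 1, J', k', K')) ` conv_index f a (j - 1) J k K"
proof (intro equalityI subsetI)
  fix x assume "x \<in> conv_index (mult_z f) a j J k K"
  then show "x \<in> (\<lambda>(j', J', k', K'). (j' + 1, J', k', K')) ` conv_index f a (j - 1) J k K"
    by (intro image_eqI[of _ _ "(fst x - 1, snd x)"]) (auto simp: conv_index_def mult_z_def)
qed (auto simp: conv_index_def mult_z_def algebra_simps)

lemma conv_index_mult_w: "conv_index (mult_w f) a j J k K =
    (\<lambda>(j', J', k', K'). (j', J', k' + 1, K')) ` conv_index f a j J (k - 1) K"
proof (intro equalityI subsetI)
  fix x assume "x \<in> conv_index (mult_w f) a j J k K"
  then show "x \<in> (\<lambda>(j', J', k', K'). (j', J', k' + 1, K')) ` conv_index f a j J (k - 1) K"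
    by (cases x) (auto intro!: image_eqI[of _ _ "(fst x, fst (snd x), fst (snd (snd x)) - 1, snd (snd (snd x)))"]
      simp: conv_index_def mult_w_def)
qed (auto simp: conv_index_def mult_w_def algebra_simps)

lemma conv_index_mult_theta:
  assumes "i \<in> J"
  shows "conv_index (mult_theta i f) a j J k K =
    (\<lambda>(j', J', k', K'). (j', insert i J', k', K')) ` conv_index f a j (J - {i}) k K"
proof (intro equalityI subsetI)
  fix x assume "x \<in> conv_index (mult_theta i f) a j J k K"
  then obtain j' J' k' K' where x: "x = (j', J', k', K')" "J' \<subseteq> J" "K' \<subseteq> K" "i \<in> J'"
    "f j' (J' - {i}) k' K' \<noteq> 0" "a (j - j') (J - J') (k - k') (K - K') \<noteq> 0"
    by (auto simp: conv_index_def mult_theta_def split: if_splits)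
  moreover have "J - {i} - (J' - {i}) = J - J'" using x by blast
  ultimately have "(j', J' - {i}, k', K') \<in> conv_index f a j (J - {i}) k K"
    by (auto simp: conv_index_def)
  then show "x \<in> (\<lambda>(j', J', k', K'). (j', insert i J', k', K')) ` conv_index f a j (J - {i}) k K"
    by (rule rev_image_eqI) (use x in auto)
next
  fix x assume "x \<in> (\<lambda>(j', J', k', K'). (j', insert i J', k', K')) ` conv_index f a j (J - {i}) k K"
  then obtain j' J' k' K' where x: "x = (j', insert i J', k', K')" "J' \<subseteq> J - {i}" "K' \<subseteq> K"
    "f j' J' k' K' \<noteq> 0" "a (j - j') (J - {i} - J') (k - k') (K - K') \<noteq> 0"
    by (auto simp: conv_index_def)
  moreover have "J - {i} - J' = J - insert i J'" "insert i J' - {i} = J'" using x by blast+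
  ultimately show "x \<in> conv_index (mult_theta i f) a j J k K"
    using assms by (auto simp: conv_index_def mult_theta_def)
qed

lemma conv_index_mult_zeta:
  assumes "i \<in> K"
  shows "conv_index (mult_zeta i f) a j J k K =
    (\<lambda>(j', J', k', K'). (j', J', k', insert i K')) ` conv_index f a j J k (K - {i})"
proof (intro equalityI subsetI)
  fix x assume "x \<in> conv_index (mult_zeta i f) a j J k K"
  then obtain j' J' k' K' where x: "x = (j', J', k', K')" "J' \<subseteq> J" "K' \<subseteq> K" "i \<in> K'"
    "f j' J' k' (K' - {i}) \<noteq> 0" "a (j - j') (J - J') (k - k') (K - K') \<noteq> 0"
    by (auto simp: conv_index_def mult_zeta_def split: if_splits)
  moreover have "K - {i} - (K' - {i}) = K - K'" using x by blast
  ultimately have "(j', J', k', K' - {i}) \<in> conv_index f a j J k (K - {i})"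
    by (auto simp: conv_index_def)
  then show "x \<in> (\<lambda>(j', J', k', K'). (j', J', k', insert i K')) ` conv_index f a j J k (K - {i})"
    by (rule rev_image_eqI) (use x in auto)
next
  fix x assume "x \<in> (\<lambda>(j', J', k', K'). (j', J', k', insert i K')) ` conv_index f a j J k (K - {i})"
  then obtain j' J' k' K' where x: "x = (j', J', k', insert i K')" "K' \<subseteq> K - {i}" "J' \<subseteq> J"
    "f j' J' k' K' \<noteq> 0" "a (j - j') (J - J') (k - k') (K - {i} - K') \<noteq> 0"
    by (auto simp: conv_index_def)
  moreover have "K - {i} - K' = K - insert i K'" "insert i K' - {i} = K'" using x by blast+
  ultimately show "x \<in> conv_index (mult_zeta i f) a j J k K"
    using assms by (auto simp: conv_index_def mult_zeta_def)
qed

lemma conv_index_mult_theta_empty: "i \<notin> J \<Longrightarrow> conv_index (mult_theta i f) a j J k K = {}"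
  by (auto simp: conv_index_def mult_theta_def)

lemma conv_index_mult_zeta_empty: "i \<notin> K \<Longrightarrow> conv_index (mult_zeta i f) a j J k K = {}"
  by (auto simp: conv_index_def mult_zeta_def)

lemma convolvable_mult_z: "convolvable f a \<Longrightarrow> convolvable (mult_z f) a"
  by (simp add: convolvable_def conv_index_mult_z)

lemma convolvable_mult_w: "convolvable f a \<Longrightarrow> convolvable (mult_w f) a"
  by (simp add: convolvable_def conv_index_mult_w)

lemma convolvable_mult_theta:
  assumes "convolvable f a" shows "convolvable (mult_theta i f) a"
  unfolding convolvable_def
proof (intro allI)
  fix j J k K
  show "finite (conv_index (mult_theta i f) a j J k K)"
    using assms by (cases "i \<in> J")
      (simp_all add: convolvable_def conv_index_mult_theta conv_index_mult_theta_empty)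
qed

lemma convolvable_mult_zeta:
  assumes "convolvable f a" shows "convolvable (mult_zeta i f) a"
  unfolding convolvable_def
proof (intro allI)
  fix j J k K
  show "finite (conv_index (mult_zeta i f) a j J k K)"
    using assms by (cases "i \<in> K")
      (simp_all add: convolvable_def conv_index_mult_zeta conv_index_mult_zeta_empty)
qed

lemma conv_index_diff:
  "conv_index (f - g) a j J k K \<subseteq> conv_index f a j J k K \<union> conv_index g a j J k K"
  by (auto simp: conv_index_def dist_apply)

lemma convolvable_diff: "convolvable f a \<Longrightarrow> convolvable g a \<Longrightarrow> convolvable (f - g) a"
  unfolding convolvable_def by (meson conv_index_diff finite_UnI finite_subset)

lemma convolvable_mult_even: "convolvable f a \<Longrightarrow> convolvable (mult_even f) a"
  by (simp add: mult_even_def convolvable_diff convolvable_mult_z convolvable_mult_w)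

lemma convolvable_mult_odd: "convolvable f a \<Longrightarrow> convolvable (mult_odd i f) a"
  by (simp add: mult_odd_def convolvable_diff convolvable_mult_theta convolvable_mult_zeta)

lemma convolvable_mult_evens: "convolvable f a \<Longrightarrow> convolvable ((mult_even ^^ n) f) a"
  by (induction n) (auto simp: convolvable_mult_even)

lemma convolvable_mult_odds: "convolvable f a \<Longrightarrow> convolvable (mult_odds xs f) a"
  by (induction xs) (auto simp: convolvable_mult_odd)

lemma conv_index_monomial: "conv_index (monomial p P q Q) a j J k K =
    (if P \<subseteq> J \<and> Q \<subseteq> K \<and> a (j - p) (J - P) (k - q) (K - Q) \<noteq> 0 then {(p, P, q, Q)} else {})"
  by (auto simp: conv_index_def monomial_def split: if_splits)

lemma convolvable_monomial: "convolvable (monomial p P q Q) a"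
  by (simp add: convolvable_def conv_index_monomial)

text \<open>Instantiated both with the coefficient space and with complex multiplication, so that
  every law for \<open>dist_mult\<close> also covers \<open>cmult\<close>.\<close>

locale complex_vector_space = vector_space scale
  for scale :: "complex \<Rightarrow> 'u::ab_group_add \<Rightarrow> 'u"
begin

definition conv_term :: "complex dist2 \<Rightarrow> 'u dist2 \<Rightarrow> int \<Rightarrow> nat set \<Rightarrow> int \<Rightarrow> nat set \<Rightarrow>
    int \<times> nat set \<times> int \<times> nat set \<Rightarrow> 'u" where
  "conv_term f a j J k K = (\<lambda>(j', J', k', K').
     scale (mono_sign J' K' (J - J') (K - K') * f j' J' k' K') (a (j - j') (J - J') (k - k') (K - K')))"

lemma dist_mult_apply: "dist_mult scale f a j J k K = sum (conv_term f a j J k K) (conv_index f a j J k K)"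
  by (simp add: dist_mult_def conv_index_def conv_term_def)

lemma scale_sg: "scale (sg n c) x = sg n (scale c x)"
  by (simp add: sg_def)

text \<open>Lets products with different supports be compared as sums over one common set. The
  inclusions required of \<open>S\<close> exclude indices where \<open>J - J'\<close> would lose
  elements and create spurious terms.\<close>

lemma dist_mult_superset:
  assumes "finite S" "conv_index f a j J k K \<subseteq> S"
    "\<And>j' J' k' K'. (j', J', k', K') \<in> S \<Longrightarrow> J' \<subseteq> J \<and> K' \<subseteq> K"
  shows "dist_mult scale f a j J k K = sum (conv_term f a j J k K) S"
  unfolding dist_mult_apply
proof (rule sum.mono_neutral_left[OF assms(1,2)], intro ballI)
  fix x assume x: "x \<in> S - conv_index f a j J k K"
  obtain j' J' k' K' where xe: "x = (j', J', k', K')" by (cases x)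
  with x assms(3) have "J' \<subseteq> J \<and> K' \<subseteq> K" by blast
  with x show "conv_term f a j J k K x = 0"
    by (auto simp: conv_term_def conv_index_def xe)
qed

lemma dist_mult_diff:
  assumes "convolvable f a" "convolvable g a"
  shows "dist_mult scale (f - g) a = dist_mult scale f a - dist_mult scale g a"
proof (intro ext)
  fix j J k K
  let ?S = "conv_index f a j J k K \<union> conv_index g a j J k K"
  have fin: "finite ?S" using assms by (simp add: convolvable_def)
  have sub: "(j', J', k', K') \<in> ?S \<Longrightarrow> J' \<subseteq> J \<and> K' \<subseteq> K" for j' J' k' K'
    by (auto simp: conv_index_def)
  have "dist_mult scale (f - g) a j J k K = sum (conv_term (f - g) a j J k K) ?S"
    by (rule dist_mult_superset[OF fin conv_index_diff sub])
  also have "\<dots> = (\<Sum>x\<in>?S. conv_term f a j J k K x - conv_term g a j J k K x)"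
    by (rule sum.cong) (auto simp: conv_term_def dist_apply right_diff_distrib scale_left_diff_distrib)
  also have "\<dots> = dist_mult scale f a j J k K - dist_mult scale g a j J k K"
    unfolding sum_subtractf
    using dist_mult_superset[OF fin _ sub, of f a] dist_mult_superset[OF fin _ sub, of g a] by simp
  finally show "dist_mult scale (f - g) a j J k K = (dist_mult scale f a - dist_mult scale g a) j J k K"
    by (simp add: dist_apply)
qed

lemma dist_mult_monomial: "dist_mult scale (monomial p P q Q) a j J k K =
    (if P \<subseteq> J \<and> Q \<subseteq> K
     then scale (mono_sign P Q (J - P) (K - Q)) (a (j - p) (J - P) (k - q) (K - Q)) else 0)"
  unfolding dist_mult_apply conv_index_monomial by (simp add: conv_term_def monomial_def)

lemma dist_mult_one: "dist_mult scale (monomial 0 {} 0 {}) a = a"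
  by (intro ext) (simp add: dist_mult_monomial mono_sign_def)

lemma dist_mult_z_minus_w: "dist_mult scale (monomial 1 {} 0 {} - monomial 0 {} 1 {}) a = mult_even a"
  by (intro ext) (simp add: dist_mult_diff convolvable_monomial dist_mult_monomial mono_sign_def
      mult_even_apply dist_apply)

lemma scale_minus_one_power: "scale ((-1) ^ n) x = sg n x"
  by (simp add: sg_def)

lemma dist_mult_theta_minus_zeta:
  "dist_mult scale (monomial 0 {i} 0 {} - monomial 0 {} 0 {i}) a = mult_odd i a"
proof (intro ext)
  fix j J k K
  have b: "below i (A - {i}) = below i A" for A
    by (cases "i \<in> A") (simp_all add: below_remove)
  show "dist_mult scale (monomial 0 {i} 0 {} - monomial 0 {} 0 {i}) a j J k K = mult_odd i a j J k K"
    by (simp add: dist_mult_diff convolvable_monomial dist_mult_monomial mono_sign_def odd_sign_singleton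
      mult_odd_apply dist_apply scale_minus_one_power b flip: power_add)
qed

lemma dist_mult_mult_z: "dist_mult scale (mult_z f) a = mult_z (dist_mult scale f a)"
proof (intro ext)
  fix j J k K
  show "dist_mult scale (mult_z f) a j J k K = mult_z (dist_mult scale f a) j J k K"
    unfolding mult_z_def[of "dist_mult scale f a"] dist_mult_apply conv_index_mult_z
    by (subst sum.reindex)
       (auto simp: inj_on_def conv_term_def mult_z_def algebra_simps intro!: sum.cong)
qed

lemma dist_mult_mult_w: "dist_mult scale (mult_w f) a = mult_w (dist_mult scale f a)"
proof (intro ext)
  fix j J k K
  show "dist_mult scale (mult_w f) a j J k K = mult_w (dist_mult scale f a) j J k K"
    unfolding mult_w_def[of "dist_mult scale f a"] dist_mult_apply conv_index_mult_w
    by (subst sum.reindex)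
       (auto simp: inj_on_def conv_term_def mult_w_def algebra_simps intro!: sum.cong)
qed

text \<open>Associativity for one generator on the left. Reindexing by \<open>insert i\<close>
  matches the supports, and \<open>below_split\<close> matches the signs.\<close>

lemma dist_mult_mult_theta:
  assumes f: "is_dist2 N f"
  shows "dist_mult scale (mult_theta i f) a = mult_theta i (dist_mult scale f a)"
proof (intro ext)
  fix j J k K
  show "dist_mult scale (mult_theta i f) a j J k K = mult_theta i (dist_mult scale f a) j J k K"
  proof (cases "i \<in> J")
    case False
    then have "conv_index (mult_theta i f) a j J k K = {}" by (rule conv_index_mult_theta_empty)
    with False show ?thesis unfolding dist_mult_apply by (simp add: mult_theta_def)
  next
    case True
    let ?h = "\<lambda>(j', J', k', K'). (j' :: int, insert i J', k' :: int, K' :: nat set)"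
    have inj: "inj_on ?h (conv_index f a j (J - {i}) k K)"
      by (auto simp: inj_on_def conv_index_def)
    have "conv_term (mult_theta i f) a j J k K (?h x) = sg (below i J) (conv_term f a j (J - {i}) k K x)"
      if x: "x \<in> conv_index f a j (J - {i}) k K" for x
    proof -
      obtain j' J' k' K' where xe: "x = (j', J', k', K')" by (cases x)
      with x have J': "J' \<subseteq> J - {i}" and nz: "f j' J' k' K' \<noteq> 0" by (auto simp: conv_index_def)
      have "finite J'" by (rule is_dist2_finite[OF f nz])
      moreover have "i \<notin> J'" "J - insert i J' = J - {i} - J'" "insert i J' - {i} = J'"
        using J' by blast+
      moreover have "below i (insert i J') = below i J'" using \<open>i \<notin> J'\<close> by (simp add: below_insert)
      ultimately show ?thesis
        unfolding xe below_split[OF J']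
        by (simp add: conv_term_def mult_theta_def mono_sign_def odd_sign_insert sg_complex
            flip: scale_sg) (simp add: power_add algebra_simps)
    qed
    then show ?thesis
      unfolding mult_theta_apply[of _ "dist_mult scale f a"] dist_mult_apply conv_index_mult_theta[OF True]
        sum.reindex[OF inj] sg_sum
      by (simp add: True cong: sum.cong)
  qed
qed

text \<open>\<open>\<zeta>^i\<close> must pass all of \<open>\<theta>^J\<close> on one side; on the
  other it passes \<open>J'\<close> inside the left factor and \<open>J - J'\<close> through
  \<open>mono_sign\<close>. The counts agree because both parts are finite, which uses
  \<open>is_dist2\<close> for both factors.\<close>

lemma dist_mult_mult_zeta:
  assumes f: "is_dist2 N f" and a: "is_dist2 N a"
  shows "dist_mult scale (mult_zeta i f) a = mult_zeta i (dist_mult scale f a)"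
proof (intro ext)
  fix j J k K
  show "dist_mult scale (mult_zeta i f) a j J k K = mult_zeta i (dist_mult scale f a) j J k K"
  proof (cases "i \<in> K")
    case False
    then have "conv_index (mult_zeta i f) a j J k K = {}" by (rule conv_index_mult_zeta_empty)
    with False show ?thesis unfolding dist_mult_apply by (simp add: mult_zeta_def)
  next
    case True
    let ?h = "\<lambda>(j', J', k', K'). (j' :: int, J' :: nat set, k' :: int, insert i K')"
    have inj: "inj_on ?h (conv_index f a j J k (K - {i}))"
      by (auto simp: inj_on_def conv_index_def)
    have "conv_term (mult_zeta i f) a j J k K (?h x) =
        sg (card J + below i K) (conv_term f a j J k (K - {i}) x)"
      if x: "x \<in> conv_index f a j J k (K - {i})" for x
    proof -
      obtain j' J' k' K' where xe: "x = (j', J', k', K')" by (cases x)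
      with x have K': "K' \<subseteq> K - {i}" and J': "J' \<subseteq> J" and nz: "f j' J' k' K' \<noteq> 0"
        and nz': "a (j - j') (J - J') (k - k') (K - {i} - K') \<noteq> 0" by (auto simp: conv_index_def)
      have fin: "finite J'" "finite K'" by (rule is_dist2_finite[OF f nz])+
      have "finite (J - J')" by (rule is_dist2_finite[OF a nz'])
      then have "card (J' \<union> (J - J')) = card J' + card (J - J')"
        using fin by (intro card_Un_disjoint) auto
      then have "card J = card J' + card (J - J')" using J' by (simp add: Un_absorb1)
      moreover have "i \<notin> K'" "K - insert i K' = K - {i} - K'" "insert i K' - {i} = K'"
        using K' by blast+
      moreover have "below i (insert i K') = below i K'" using \<open>i \<notin> K'\<close> by (simp add: below_insert)
      ultimately show ?thesis
        unfolding xe below_split[OF K'] using fin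
        by (simp add: conv_term_def mult_zeta_def mono_sign_def odd_sign_insert sg_complex
            flip: scale_sg) (simp add: power_add algebra_simps)
    qed
    then show ?thesis
      unfolding mult_zeta_apply[of _ "dist_mult scale f a"] dist_mult_apply conv_index_mult_zeta[OF True]
        sum.reindex[OF inj] sg_sum
      by (simp add: True cong: sum.cong)
  qed
qed

lemma dist_mult_mult_even:
  assumes "convolvable f a"
  shows "dist_mult scale (mult_even f) a = mult_even (dist_mult scale f a)"
  using assms by (simp add: mult_even_def dist_mult_diff convolvable_mult_z convolvable_mult_w
      dist_mult_mult_z dist_mult_mult_w)

lemma dist_mult_mult_odd:
  assumes "is_dist2 N f" "is_dist2 N a" "convolvable f a"
  shows "dist_mult scale (mult_odd i f) a = mult_odd i (dist_mult scale f a)"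
  using assms by (simp add: mult_odd_def dist_mult_diff convolvable_mult_theta convolvable_mult_zeta
      dist_mult_mult_theta[of N] dist_mult_mult_zeta[of N])

lemma dist_mult_mult_evens:
  assumes "convolvable f a"
  shows "dist_mult scale ((mult_even ^^ n) f) a = (mult_even ^^ n) (dist_mult scale f a)"
  by (induction n) (simp_all add: dist_mult_mult_even convolvable_mult_evens assms)

lemma dist_mult_mult_odds:
  assumes "is_dist2 N f" "is_dist2 N a" "convolvable f a" "set xs \<subseteq> {1..N}"
  shows "dist_mult scale (mult_odds xs f) a = mult_odds xs (dist_mult scale f a)"
  using assms(4)
proof (induction xs)
  case (Cons x xs)
  then have "is_dist2 N (mult_odds xs f)" using assms(1) by (intro is_dist2_mult_odds) auto
  from dist_mult_mult_odd[OF this assms(2) convolvable_mult_odds[OF assms(3)], of x] Cons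
  show ?case by simp
qed simp

lemma is_dist2_dist_mult:
  assumes f: "is_dist2 N f" and a: "is_dist2 N a"
  shows "is_dist2 N (dist_mult scale f a)"
  unfolding is_dist2_def
proof (intro allI impI)
  fix j J k K assume "dist_mult scale f a j J k K \<noteq> 0"
  then have "conv_index f a j J k K \<noteq> {}" by (auto simp: dist_mult_apply)
  then obtain j' J' k' K' where *: "f j' J' k' K' \<noteq> 0" "a (j - j') (J - J') (k - k') (K - K') \<noteq> 0"
    by (auto simp: conv_index_def)
  have "J' \<subseteq> {1..N}" "K' \<subseteq> {1..N}" "J - J' \<subseteq> {1..N}" "K - K' \<subseteq> {1..N}"
    using f a * unfolding is_dist2_def by metis+
  then show "J \<subseteq> {1..N} \<and> K \<subseteq> {1..N}" by blast
qed

end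

interpretation complex_mult: complex_vector_space "(*) :: complex \<Rightarrow> complex \<Rightarrow> complex"
  by unfold_locales (simp_all add: algebra_simps)

abbreviation dist_one :: "complex dist2" where
  "dist_one \<equiv> monomial 0 {} 0 {}"

lemma is_dist2_one: "is_dist2 N dist_one"
  by (simp add: is_dist2_def monomial_def)

lemma even_diff_power_eq: "even_diff_power n = (mult_even ^^ n) dist_one"
proof -
  have "cmult (monomial 1 {} 0 {} - monomial 0 {} 1 {}) = mult_even"
    by (rule ext) (rule complex_mult.dist_mult_z_minus_w)
  then show ?thesis by (simp add: even_diff_power_def)
qed

lemma odd_diff_prod_eq: "odd_diff_prod J = mult_odds (sorted_list_of_set J) dist_one"
proof -
  have "(\<lambda>i. cmult (monomial 0 {i} 0 {} - monomial 0 {} 0 {i})) = mult_odd"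
    by (intro ext) (simp only: complex_mult.dist_mult_theta_minus_zeta)
  then show ?thesis by (simp add: odd_diff_prod_def)
qed

lemma set_sorted_subset: "(J :: nat set) \<subseteq> {1..N} \<Longrightarrow> set (sorted_list_of_set J) = J"
  using finite_subset[OF _ finite_atLeastAtMost, of J 1 N] by simp

lemma diff_power_eq: "diff_power j J = (mult_even ^^ j) (mult_odds (sorted_list_of_set J) dist_one)"
  unfolding diff_power_def even_diff_power_eq odd_diff_prod_eq
  by (simp add: complex_mult.dist_mult_mult_evens convolvable_monomial complex_mult.dist_mult_one)

context complex_vector_space
begin

lemma dist_mult_even_diff_power: "dist_mult scale (even_diff_power n) a = (mult_even ^^ n) a"
  by (simp add: even_diff_power_eq dist_mult_mult_evens convolvable_monomial dist_mult_one)

text \<open>Translates the residues of the theorem into the operator calculus.\<close>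

lemma dist_mult_diff_power:
  assumes "is_dist2 N a" "J \<subseteq> {1..N}"
  shows "dist_mult scale (diff_power j J) a = (mult_even ^^ j) (mult_odds (sorted_list_of_set J) a)"
  using dist_mult_mult_odds[OF is_dist2_one assms(1) convolvable_monomial, of "sorted_list_of_set J"]
  by (simp add: diff_power_eq dist_mult_mult_evens convolvable_mult_odds convolvable_monomial
      dist_mult_one set_sorted_subset[OF assms(2)] assms(2) del: One_nat_def)

end

section \<open>Powers of the even operator against powers of the w-derivative\<close>

definition smul :: "complex \<Rightarrow> complex dist2 \<Rightarrow> complex dist2" where
  "smul c f = (\<lambda>j J k K. c * f j J k K)"

lemma mult_even_smul: "mult_even (smul c f) = smul c (mult_even f)"
  by (intro ext) (simp add: mult_even_apply smul_def right_diff_distrib)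

lemma mult_evens_smul: "(mult_even ^^ n) (smul c f) = smul c ((mult_even ^^ n) f)"
  by (induction n) (simp_all add: mult_even_smul)

lemma mult_odd_smul: "mult_odd i (smul c f) = smul c (mult_odd i f)"
  by (intro ext) (simp add: mult_odd_apply smul_def sg_complex right_diff_distrib mult.left_commute)

lemma mult_odds_smul: "mult_odds xs (smul c f) = smul c (mult_odds xs f)"
  by (induction xs) (simp_all add: mult_odd_smul)

lemma smul_smul: "smul c (smul d f) = smul (c * d) f"
  by (intro ext) (simp add: smul_def)

lemma smul_0: "smul c 0 = 0"
  by (intro ext) (simp add: smul_def dist_apply)

lemma homogeneous_smul:
  assumes "homogeneous N p q f" shows "homogeneous N p q (smul c f)"
  unfolding homogeneous_def
proof (intro allI impI)
  fix j J k K assume "smul c f j J k K \<noteq> 0"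
  then have "f j J k K \<noteq> 0" by (simp add: smul_def)
  from homogeneousD[OF assms this]
  show "J \<subseteq> {1..N} \<and> K \<subseteq> {1..N} \<and> j + k = p \<and> int (card J + card K) = q" by simp
qed

lemma divided_deriv_W_eq: "divided_deriv_W m J f =
   smul ((-1) ^ (card J * (card J + 1) div 2) / fact m)
     ((deriv_w ^^ m) (deriv_zetas (sorted_list_of_set J) f))"
  unfolding divided_deriv_W_def smul_def deriv_W_def ..

text \<open>Moving E through r + 1 copies of D_w collects one commutator from each; the last term
  contains E v = 0.\<close>

lemma mult_even_deriv_w_power:
  assumes "mult_even v = 0"
  shows "mult_even ((deriv_w ^^ Suc r) v) = smul (of_nat (Suc r)) ((deriv_w ^^ r) v)"
proof (induction r)
  case 0
  show ?case by (simp add: mult_even_deriv_w assms smul_def)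
next
  case (Suc r)
  have "mult_even ((deriv_w ^^ Suc (Suc r)) v) =
      deriv_w (mult_even ((deriv_w ^^ Suc r) v)) + (deriv_w ^^ Suc r) v"
    unfolding funpow.simps(2)[of "Suc r"] comp_apply by (rule mult_even_deriv_w)
  also have "\<dots> = deriv_w (smul (of_nat (Suc r)) ((deriv_w ^^ r) v)) + (deriv_w ^^ Suc r) v"
    by (simp only: Suc.IH)
  also have "\<dots> = smul (of_nat (Suc (Suc r))) ((deriv_w ^^ Suc r) v)"
  proof (intro ext)
    fix j J k K
    define x where "x = (deriv_w ^^ r) v j J (k + 1) K"
    show "(deriv_w (smul (of_nat (Suc r)) ((deriv_w ^^ r) v)) + (deriv_w ^^ Suc r) v) j J k K =
        smul (of_nat (Suc (Suc r))) ((deriv_w ^^ Suc r) v) j J k K"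
      unfolding funpow.simps(2) comp_apply dist_apply smul_def deriv_w_apply x_def[symmetric]
      by (simp add: distrib_left distrib_right)
  qed
  finally show ?case .
qed

text \<open>Each E strips one D_w and contributes the current exponent, which gives a falling
  factorial.\<close>

lemma mult_evens_deriv_w_power_le:
  assumes "mult_even v = 0"
  shows "(mult_even ^^ j) ((deriv_w ^^ (j + r)) v) = smul (fact (j + r) / fact r) ((deriv_w ^^ r) v)"
proof (induction j arbitrary: r)
  case 0
  show ?case by (simp add: smul_def)
next
  case (Suc j)
  have "(mult_even ^^ Suc j) ((deriv_w ^^ (Suc j + r)) v) =
      mult_even ((mult_even ^^ j) ((deriv_w ^^ (j + Suc r)) v))"
    by simp
  also have "\<dots> = smul (fact (j + Suc r) / fact (Suc r) * of_nat (Suc r)) ((deriv_w ^^ r) v)"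
    by (simp only: Suc.IH mult_even_smul mult_even_deriv_w_power[OF assms] smul_smul)
  also have "fact (j + Suc r) / fact (Suc r) * of_nat (Suc r) = (fact (Suc j + r) / fact r :: complex)"
  proof -
    have "x / (s * y) * s = x / y" if "s \<noteq> 0" for x y s :: complex
      using that by simp
    from this[OF of_nat_neq_0] show ?thesis by (simp only: add_Suc_right add_Suc fact_Suc[of r])
  qed
  finally show ?case .
qed

text \<open>After m factors only a multiple of v is left, and the next E annihilates it.\<close>

lemma mult_evens_deriv_w_power_gt:
  assumes "mult_even v = 0" "m < j"
  shows "(mult_even ^^ j) ((deriv_w ^^ m) v) = 0"
proof -
  obtain d where d: "j = d + Suc m"
    using less_imp_Suc_add[OF assms(2)] by (auto simp: add.commute)
  have "(mult_even ^^ Suc m) ((deriv_w ^^ m) v) = 0"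
    using mult_evens_deriv_w_power_le[OF assms(1), of m 0] by (simp add: mult_even_smul assms(1) smul_0)
  then show ?thesis unfolding d funpow_add comp_def by (simp add: mult_evens_0 del: funpow.simps)
qed

section \<open>The delta distribution in operator form\<close>

text \<open>The purely even delta: the sum of z^(-1-n) w^n over all integers n.\<close>

definition even_delta :: "complex dist2" where
  "even_delta = inv_diff_zw - inv_diff_wz"

lemma even_delta_apply: "even_delta j J k K = (if J = {} \<and> K = {} \<and> j + k = - 1 then 1 else 0)"
  by (auto simp: even_delta_def inv_diff_zw_def inv_diff_wz_def dist_apply)

lemma homogeneous_even_delta: "homogeneous N (- 1) 0 even_delta"
  by (simp add: homogeneous_def even_delta_apply)

lemma mult_even_even_delta: "mult_even even_delta = 0"
  by (intro ext) (simp add: mult_even_apply even_delta_apply dist_apply)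

text \<open>The H_i do not touch the exponents of z and w, so the even series and the polynomial in
  the odd variables separate.\<close>

lemma mult_odds_even:
  assumes "\<And>j J k K. g j J k K \<noteq> 0 \<Longrightarrow> J = {} \<and> K = {}"
  shows "mult_odds xs g j J k K = g j {} k {} * mult_odds xs dist_one 0 J 0 K"
proof (induction xs arbitrary: J K)
  case Nil
  show ?case using assms[of j J k K] by (auto simp: monomial_def)
next
  case (Cons x xs)
  show ?case by (simp add: mult_odd_apply[of x] Cons sg_complex right_diff_distrib mult.left_commute)
qed

text \<open>In the definition of delta the operators build the right factor, out of reach of the
  rules that move them out of the left one. Here the product is evaluated directly: the odd
  polynomial contains no z or w and \<open>g\<close> no odd variable, so a single index
  contributes.\<close>

lemma cmult_even_odds:
  assumes "\<And>j J k K. g j J k K \<noteq> 0 \<Longrightarrow> J = {} \<and> K = {}"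
  shows "cmult g (mult_odds xs dist_one) = mult_odds xs g"
proof (intro ext)
  fix j J k K
  have h: "mult_odds xs dist_one j J k K = 0" if "j \<noteq> 0 \<or> k \<noteq> 0" for j J k K
  proof -
    have "mult_odds xs dist_one j J k K = dist_one j {} k {} * mult_odds xs dist_one 0 J 0 K"
      by (rule mult_odds_even) (simp add: monomial_def split: if_splits)
    then show ?thesis using that by (auto simp: monomial_def)
  qed
  have "conv_index g (mult_odds xs dist_one) j J k K \<subseteq> {(j, {}, k, {})}"
  proof
    fix x assume x: "x \<in> conv_index g (mult_odds xs dist_one) j J k K"
    obtain j' J' k' K' where xe: "x = (j', J', k', K')" by (cases x)
    have nz: "g j' J' k' K' \<noteq> 0" "mult_odds xs dist_one (j - j') (J - J') (k - k') (K - K') \<noteq> 0"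
      using x by (simp_all add: xe conv_index_def)
    have "J' = {} \<and> K' = {}" using assms[OF nz(1)] .
    moreover have "j - j' = 0 \<and> k - k' = 0" using h[of "j - j'" "k - k'"] nz(2) by metis
    ultimately show "x \<in> {(j, {}, k, {})}" by (simp add: xe)
  qed
  then have "cmult g (mult_odds xs dist_one) j J k K =
      sum (complex_mult.conv_term g (mult_odds xs dist_one) j J k K) {(j, {}, k, {})}"
    by (intro complex_mult.dist_mult_superset) auto
  then show "cmult g (mult_odds xs dist_one) j J k K = mult_odds xs g j J k K"
    using mult_odds_even[of g xs j J k K] assms by (simp add: complex_mult.conv_term_def mono_sign_def)
qed

lemma super_delta_eq: "super_delta N = mult_odds (sorted_list_of_set {1..N}) even_delta"
proof -
  have zw: "cmult inv_diff_zw (odd_diff_prod {1..N}) = mult_odds (sorted_list_of_set {1..N}) inv_diff_zw"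
    unfolding odd_diff_prod_eq by (rule cmult_even_odds) (auto simp: inv_diff_zw_def split: if_splits)
  have wz: "cmult inv_diff_wz (odd_diff_prod {1..N}) = mult_odds (sorted_list_of_set {1..N}) inv_diff_wz"
    unfolding odd_diff_prod_eq by (rule cmult_even_odds) (auto simp: inv_diff_wz_def split: if_splits)
  have "mult_odds (sorted_list_of_set {1..N}) inv_diff_zw =
      mult_odds (sorted_list_of_set {1..N}) (even_delta + inv_diff_wz)"
    by (simp add: even_delta_def)
  then show ?thesis unfolding super_delta_def zw wz mult_odds_add by simp
qed

text \<open>Each factor \<open>\<theta>^x - \<zeta>^x\<close> adds at most one theta.\<close>

lemma mult_odds_vanish:
  assumes "\<And>J K. card J > r \<Longrightarrow> b j J k K = 0" "card J > r + length xs"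
  shows "mult_odds xs b j J k K = 0"
  using assms(2)
proof (induction xs arbitrary: J K)
  case Nil
  then show ?case using assms(1) by simp
next
  case (Cons x xs)
  have "finite J" using Cons.prems by (metis card.infinite not_less_zero)
  then have "x \<in> J \<Longrightarrow> card J = Suc (card (J - {x}))" by (simp only: card_Suc_Diff1)
  then have "x \<in> J \<Longrightarrow> card (J - {x}) > r + length xs" using Cons.prems by simp
  then show ?case using Cons by (simp add: mult_odd_apply[of x] del: card_Diff_singleton card_Diff_insert)
qed

text \<open>If \<open>b\<close> has at most \<open>card I\<close> thetas, then
  \<open>I \<union> set xs\<close> is reached only by taking the theta part of every factor. As
  \<open>xs\<close> is sorted, \<open>x\<close> is smaller than the remaining indices, so only
  \<open>I\<close> contributes to the sign.\<close>

lemma mult_odds_top: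
  assumes "\<And>J K. card J > card I \<Longrightarrow> b j J k K = 0"
    and I: "finite I" "set xs \<inter> I = {}" and xs: "sorted xs" "distinct xs"
  shows "mult_odds xs b j (I \<union> set xs) k K = sg (\<Sum>x\<leftarrow>xs. below x I) (b j I k K)"
  using I xs
proof (induction xs arbitrary: K)
  case Nil
  show ?case by (simp add: sg_def)
next
  case (Cons x xs)
  let ?S = "I \<union> set (x # xs)"
  have "card ?S = card I + length (x # xs)"
    using Cons.prems by (subst card_Un_disjoint) (auto simp: distinct_card)
  then have 0: "mult_odds xs b j ?S k K' = 0" for K'
    by (intro mult_odds_vanish[of "card I"] assms(1)) simp_all
  have S: "?S - {x} = I \<union> set xs" using Cons.prems by auto
  have "{l \<in> ?S. l < x} = {l \<in> I. l < x}" using Cons.prems by auto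
  then have b: "below x ?S = below x I" by (simp add: below_def)
  have x: "x \<in> ?S" by simp
  have "mult_odds (x # xs) b j ?S k K = sg (below x I) (mult_odds xs b j (I \<union> set xs) k K)"
    by (simp only: foldr.simps comp_apply mult_odd_apply x if_True S b 0 sg_0 if_cancel diff_zero)
  also have "\<dots> = sg (\<Sum>x\<leftarrow>x # xs. below x I) (b j I k K)"
    using Cons by (simp add: sg_sg)
  finally show ?case .
qed

lemma homogeneous_super_delta: "homogeneous N (- 1) (int N) (super_delta N)"
  using homogeneous_mult_odds[OF homogeneous_even_delta, of "sorted_list_of_set {1..N}" N]
  by (simp add: super_delta_eq)

lemma mult_even_super_delta: "mult_even (super_delta N) = 0"
  by (simp add: super_delta_eq mult_even_odds mult_even_even_delta mult_odds_0)

lemma mult_odd_super_delta: "i \<in> {1..N} \<Longrightarrow> mult_odd i (super_delta N) = 0"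
  unfolding super_delta_eq
  by (rule mult_odd_mult_odds_eq_0[OF homogeneous_is_dist2[OF homogeneous_even_delta, of N]]) auto

lemma super_delta_top: "super_delta N (- 1) {1..N} k K = (if k = 0 \<and> K = {} then 1 else 0)"
proof -
  have "super_delta N (- 1) ({} \<union> set (sorted_list_of_set {1..N})) k K
      = sg (\<Sum>x\<leftarrow>sorted_list_of_set {1..N}. below x {}) (even_delta (- 1) {} k K)"
    unfolding super_delta_eq by (rule mult_odds_top) (auto simp: even_delta_apply)
  also have "(\<Sum>x\<leftarrow>sorted_list_of_set {1..N}. below x {}) = 0"
    by (simp add: below_def)
  finally show ?thesis by (simp add: even_delta_apply sg_def)
qed

section \<open>Residues of the derivatives of delta\<close>

text \<open>In degree -1 the coefficient of z^(-1) is constant in w.\<close>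

lemma deriv_w_power_residue:
  assumes "homogeneous N (- 1) q v"
  shows "(deriv_w ^^ Suc r) v (- 1) J k K = 0"
proof (induction r arbitrary: k)
  case 0
  show ?case using homogeneousD(3)[OF assms, of "- 1" J "k + 1" K] by (auto simp: deriv_w_apply)
next
  case (Suc r)
  show ?case
    unfolding funpow.simps(2)[of "Suc r"] comp_apply deriv_w_apply[of "(deriv_w ^^ Suc r) v"]
    by (simp only: Suc.IH mult_zero_right)
qed

lemma homogeneous_divided_deriv:
  "homogeneous N (- 1 - int m) (int N - int (card J)) (divided_deriv_W m J (super_delta N))"
proof -
  have "homogeneous N (- 1) (int N - int (card J)) (deriv_zetas (sorted_list_of_set J) (super_delta N))"
    using homogeneous_deriv_zetas[OF homogeneous_super_delta[of N], of "sorted_list_of_set J"]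
    by (simp only: length_sorted_list_of_set)
  then show ?thesis
    unfolding divided_deriv_W_eq by (intro homogeneous_smul homogeneous_deriv_ws)
qed

lemma mult_evens_divided_deriv:
  assumes "m < n"
  shows "(mult_even ^^ n) (divided_deriv_W m J (super_delta N)) = 0"
  unfolding divided_deriv_W_eq mult_evens_smul
  by (subst mult_evens_deriv_w_power_gt)
    (simp_all add: assms mult_even_deriv_zetas mult_even_super_delta deriv_zetas_0 smul_0)

lemma deriv_w_smul: "deriv_w (smul c f) = smul c (deriv_w f)"
  by (intro ext) (simp add: deriv_w_apply smul_def)

lemma residue_divided_deriv:
  assumes J: "J \<subseteq> {1..N}" and J': "J' \<subseteq> {1..N}"
  shows "(mult_even ^^ j) (mult_odds (sorted_list_of_set J) (divided_deriv_W m J' (super_delta N)))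
      (- 1) {1..N} k K = (if j = m \<and> J = J' \<and> k = 0 \<and> K = {} then 1 else 0)"
proof -
  let ?v = "super_delta N" and ?xs = "sorted_list_of_set J" and ?ys = "sorted_list_of_set J'"
  define T where "T = card J' * (card J' + 1) div 2"
  let ?c = "(-1) ^ T / fact m :: complex"
  define X where "X = mult_odds ?xs (deriv_zetas ?ys ?v)"
  have fin: "finite J" "finite J'" using J J' finite_subset by blast+
  have set_xs: "set ?xs = J" and set_ys: "set ?ys = J'"
    using J J' by (simp_all add: set_sorted_subset)
  have v: "is_dist2 N ?v" by (rule homogeneous_is_dist2[OF homogeneous_super_delta])
  have eq: "(mult_even ^^ j) (mult_odds ?xs (divided_deriv_W m J' ?v)) =
      smul ?c ((mult_even ^^ j) ((deriv_w ^^ m) X))"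
    unfolding divided_deriv_W_eq T_def[symmetric] mult_odds_smul mult_evens_smul X_def deriv_ws_mult_odds ..
  consider "J = J'" | i where "i \<in> J" "i \<notin> J'" | "J \<subset> J'" by blast
  then show ?thesis
  proof cases
    case 1
    have X: "X = sg T ?v"
    proof -
      have "\<forall>x\<in>set ?ys. mult_odd x ?v = 0" using set_ys J' mult_odd_super_delta by blast
      from mult_odds_deriv_zetas_same[OF v _ this] show ?thesis
        by (simp only: X_def T_def 1 length_sorted_list_of_set distinct_sorted_list_of_set)
    qed
    \<comment> \<open>This sign occurs twice, from the divided derivative and from \<open>X\<close>,
      hence \<open>s * s = 1\<close> below.\<close>
    define s where "s = ((-1) ^ T :: complex)"
    have ss: "s * s = 1" by (simp add: s_def flip: power_add mult_2)
    have Xs: "X = smul s ?v"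
      unfolding X s_def by (intro ext) (simp add: sg_apply sg_complex smul_def)
    have Ds: "(deriv_w ^^ m) (smul s ?v) = smul s ((deriv_w ^^ m) ?v)" for m
      by (induction m) (simp_all add: deriv_w_smul)
    have main: "smul ?c ((mult_even ^^ j) ((deriv_w ^^ m) X)) =
        smul (1 / fact m) ((mult_even ^^ j) ((deriv_w ^^ m) ?v))"
      unfolding Xs Ds mult_evens_smul smul_smul s_def[symmetric] by (simp add: ss)
    consider "j = m" | r where "m = j + Suc r" | "m < j"
      using less_imp_Suc_add[of j m] by (cases j m rule: linorder_cases) auto
    then show ?thesis
    proof cases
      case jm: 1
      have "(mult_even ^^ m) ((deriv_w ^^ m) ?v) = smul (fact m) ?v"
        using mult_evens_deriv_w_power_le[OF mult_even_super_delta, of m 0] by simp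
      then have "smul (1 / fact m) ((mult_even ^^ m) ((deriv_w ^^ m) ?v)) = ?v"
        by (intro ext) (simp add: smul_def)
      then show ?thesis unfolding eq main unfolding jm by (simp add: super_delta_top 1 del: One_nat_def)
    next
      case 2
      then show ?thesis unfolding eq main
        by (simp only: mult_evens_deriv_w_power_le[OF mult_even_super_delta])
           (simp add: smul_def deriv_w_power_residue[OF homogeneous_super_delta] del: funpow.simps)
    next
      case 3
      then show ?thesis unfolding eq main
        by (simp add: mult_evens_deriv_w_power_gt[OF mult_even_super_delta] smul_0 dist_apply)
    qed
  next
    case 2
    \<comment> \<open>With \<open>i \<notin> J'\<close>, H_i anticommutes with every derivative
      present and reaches delta.\<close>
    have "mult_odd i (deriv_zetas ?ys ?v) = 0"
      using mult_odd_deriv_zetas[OF v, of i ?ys] 2 J set_ys mult_odd_super_delta[of i N]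
      by (auto simp: deriv_zetas_0)
    then have "X = 0"
      unfolding X_def using mult_odds_eq_0[OF is_dist2_deriv_zetas[OF v], of ?xs i] 2 J set_xs by simp
    moreover have "(deriv_w ^^ m) 0 = 0" by (induction m) simp_all
    ultimately show ?thesis unfolding eq using 2 by (auto simp: mult_evens_0 smul_0 dist_apply)
  next
    case 3
    \<comment> \<open>The result has N - #J' + #J < N odd variables, too few for the N thetas of the
      residue monomial.\<close>
    have "card J < card J'" using 3 fin by (simp add: psubset_card_mono)
    moreover have "homogeneous N (- 1 - int m + int j) (int N - int (card J') + int (length ?xs))
        ((mult_even ^^ j) (mult_odds ?xs (divided_deriv_W m J' ?v)))"
      using homogeneous_mult_evens[OF homogeneous_mult_odds[OF homogeneous_divided_deriv]] J set_xs
      by blast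
    ultimately have "(mult_even ^^ j) (mult_odds ?xs (divided_deriv_W m J' ?v)) (- 1) {1..N} k K = 0"
      using homogeneousD(4)[of N _ _ _ "- 1" "{1..N}" k K] by fastforce
    then show ?thesis using 3 by auto
  qed
qed

section \<open>Products with distributions in W, and sums\<close>

lemma is_dist2_as_dist_W: "is_dist1 N c \<Longrightarrow> is_dist2 N (as_dist_W c)"
  by (auto simp: is_dist1_def is_dist2_def as_dist_W_def split: if_splits)

text \<open>The right factor has no z or theta, so \<open>j' = j\<close> and \<open>J' = J\<close>;
  homogeneity then fixes \<open>k'\<close>, and \<open>K'\<close> ranges over a finite power
  set.\<close>

lemma convolvable_as_dist_W:
  assumes "homogeneous N p q f"
  shows "convolvable f (as_dist_W c)"
  unfolding convolvable_def
proof (intro allI)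
  fix j J k K
  have "conv_index f (as_dist_W c) j J k K \<subseteq> {j} \<times> {J} \<times> {p - j} \<times> Pow {1..N}"
  proof
    fix x assume x: "x \<in> conv_index f (as_dist_W c) j J k K"
    obtain j' J' k' K' where xe: "x = (j', J', k', K')" by (cases x)
    have J': "J' \<subseteq> J" and nz: "f j' J' k' K' \<noteq> 0" and "j - j' = 0 \<and> J - J' = {}"
      using x by (auto simp: xe conv_index_def as_dist_W_def split: if_splits)
    then have "j' = j" "J' = J" by auto
    with homogeneousD[OF assms nz] show "x \<in> {j} \<times> {J} \<times> {p - j} \<times> Pow {1..N}"
      by (auto simp: xe)
  qed
  then show "finite (conv_index f (as_dist_W c) j J k K)" by (rule finite_subset) simp
qed

lemma mult_odds_sum: "mult_odds xs (sum g S) = (\<Sum>x\<in>S. mult_odds xs (g x))"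
  using sum_comp_morphism[of "mult_odds xs" g S] by (simp add: mult_odds_0 mult_odds_add comp_def)

lemma mult_evens_sum: "(mult_even ^^ n) (sum g S) = (\<Sum>x\<in>S. (mult_even ^^ n) (g x))"
  using sum_comp_morphism[of "mult_even ^^ n" g S] by (simp add: mult_evens_0 mult_evens_add comp_def)

lemma dist_sum_apply: "(sum g S :: 'a::ab_group_add dist2) j J k K = (\<Sum>x\<in>S. g x j J k K)"
  using sum_comp_morphism[of "\<lambda>a. a j J k K" g S] by (simp add: dist_apply comp_def)

lemma is_dist2D:
  assumes "is_dist2 N f" "f j J k K \<noteq> 0"
  shows "J \<subseteq> {1..N}" "K \<subseteq> {1..N}"
  using assms unfolding is_dist2_def by metis+

lemma is_dist2_sum:
  fixes g :: "'b \<Rightarrow> 'a::ab_group_add dist2"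
  assumes "\<And>x. x \<in> S \<Longrightarrow> is_dist2 N (g x)"
  shows "is_dist2 N (sum g S)"
  unfolding is_dist2_def
proof (intro allI impI)
  fix j J k K assume "sum g S j J k K \<noteq> 0"
  then obtain x where "x \<in> S" "g x j J k K \<noteq> 0"
    unfolding dist_sum_apply by (rule sum.not_neutral_contains_not_neutral)
  then show "J \<subseteq> {1..N} \<and> K \<subseteq> {1..N}" using is_dist2D[OF assms] by metis
qed

section \<open>A local distribution is determined by its residues\<close>

text \<open>E a satisfies both hypotheses with a smaller exponent, so by induction E a = 0 at
  \<open>I\<close> and \<open>K\<close>, and the case of a single E remains.\<close>

lemma mult_even_power_injective:
  assumes "\<And>j k. (mult_even ^^ n) a j I k K = 0" "\<And>m k. (mult_even ^^ m) a (- 1) I k K = 0"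
  shows "a j I k K = 0"
  using assms
proof (induction n arbitrary: a j k)
  case 0
  then show ?case by simp
next
  case (Suc n)
  have "mult_even a j I k K = 0" for j k
  proof (rule Suc.IH)
    show "(mult_even ^^ n) (mult_even a) j I k K = 0" for j k
      using Suc.prems(1)[of j k] by (simp add: funpow_swap1)
    show "(mult_even ^^ m) (mult_even a) (- 1) I k K = 0" for m k
      using Suc.prems(2)[of "Suc m" k] by (simp add: funpow_swap1)
  qed
  \<comment> \<open>The coefficients are constant along the lines j + k = const, and each line meets
    j = -1, where they vanish.\<close>
  then have step: "a (j - 1) I k K = a j I (k - 1) K" for j k
    by (simp add: mult_even_apply)
  have base0: "a (- 1) I k K = 0" for k using Suc.prems(2)[of 0 k] by simp
  show ?case
  proof (induction j arbitrary: k rule: int_induct[where k = "- 1"])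
    case base
    show ?case by (rule base0)
  next
    case (step1 i)
    then show ?case using step[of "i + 1" "k + 1"] by simp
  next
    case (step2 i)
    then show ?case using step[of i k] by simp
  qed
qed

text \<open>The residue monomial carries all thetas, so it sees coefficients of
  \<open>\<theta>^I\<close> for many \<open>I\<close> at once; the descending order of
  \<open>card I\<close> removes the larger ones before \<open>I\<close> is treated.\<close>

lemma residues_injective:
  assumes a: "is_dist2 N a" and loc: "(mult_even ^^ n) a = 0"
    and res: "\<And>j J k K. J \<subseteq> {1..N} \<Longrightarrow>
      (mult_even ^^ j) (mult_odds (sorted_list_of_set J) a) (- 1) {1..N} k K = 0"
  shows "a = 0"
proof -
  have "a j I k K = 0" if "I \<subseteq> {1..N}" for j I k K
    using that
  proof (induction "N - card I" arbitrary: I j k K rule: less_induct)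
    case less
    have I: "finite I" using less.prems finite_subset by blast
    have above: "a j J k K = 0" if "card J > card I" for j J k K
    proof (cases "J \<subseteq> {1..N}")
      case True
      then have "card J \<le> N" using card_mono[of "{1..N}" J] by simp
      then show ?thesis using less.hyps[of J] that True by simp
    next
      case False
      then show ?thesis using a unfolding is_dist2_zero_iff by simp
    qed
    \<comment> \<open>E shifts only the exponents of z and w, so it preserves the vanishing above
      \<open>I\<close>.\<close>
    have above': "(mult_even ^^ m) a j J k K = 0" if "card J > card I" for m j J k K
      using that by (induction m arbitrary: j k) (simp_all add: above mult_even_apply)
    \<comment> \<open>The complement of \<open>I\<close> supplies exactly the thetas missing from
      \<open>\<theta>^I\<close>.\<close>
    let ?xs = "sorted_list_of_set ({1..N} - I)"
    have "(mult_even ^^ m) a (- 1) I k K = 0" for m k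
    proof -
      have "mult_odds ?xs ((mult_even ^^ m) a) (- 1) (I \<union> set ?xs) k K =
          sg (\<Sum>x\<leftarrow>?xs. below x I) ((mult_even ^^ m) a (- 1) I k K)"
        by (rule mult_odds_top) (auto simp: above' I)
      moreover have "I \<union> set ?xs = {1..N}" using less.prems by auto
      moreover have "mult_odds ?xs ((mult_even ^^ m) a) (- 1) {1..N} k K = 0"
        using res[of "{1..N} - I" m k K] by (simp only: mult_evens_odds Diff_subset)
      ultimately show ?thesis by simp
    qed
    then show ?case
      by (rule mult_even_power_injective[where a = a and n = n, rotated]) (simp add: loc dist_apply)
  qed
  then have "a j I k K = 0" for j I k K
    using is_dist2D(1)[OF a, of j I k K] by blast
  then show ?thesis by (intro ext) (simp add: dist_apply)
qed

section \<open>Coefficients and existence of the decomposition\<close>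

context complex_vector_space
begin

text \<open>Taking the residue in Z commutes with right multiplication by a distribution in W; as
  the residue of \<open>f\<close> is the constant \<open>e\<close>, only one term survives.\<close>

lemma residue_dist_mult_as_dist_W:
  assumes "\<And>k K. f (- 1) {1..N} k K = (if k = 0 \<and> K = {} then e else 0)"
  shows "dist_mult scale f (as_dist_W c) (- 1) {1..N} k K = scale e (c k K)"
proof -
  have "conv_index f (as_dist_W c) (- 1) {1..N} k K \<subseteq> {(- 1, {1..N}, 0, {})}"
  proof
    fix x assume x: "x \<in> conv_index f (as_dist_W c) (- 1) {1..N} k K"
    obtain j' J' k' K' where xe: "x = (j', J', k', K')" by (cases x)
    have "J' \<subseteq> {1..N}" and nz: "f j' J' k' K' \<noteq> 0" and "- 1 - j' = 0 \<and> {1..N} - J' = {}"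
      using x by (auto simp: xe conv_index_def as_dist_W_def split: if_splits)
    then have j': "j' = - 1" "J' = {1..N}" by auto
    with nz assms[of k' K'] have "k' = 0 \<and> K' = {}" by metis
    with j' show "x \<in> {(- 1, {1..N}, 0, {})}" by (simp add: xe)
  qed
  then have "dist_mult scale f (as_dist_W c) (- 1) {1..N} k K =
      sum (conv_term f (as_dist_W c) (- 1) {1..N} k K) {(- 1, {1..N}, 0, {})}"
    by (intro dist_mult_superset) auto
  then show ?thesis
    using assms[of 0 "{}"] by (simp add: conv_term_def mono_sign_def as_dist_W_def del: One_nat_def)
qed

lemma residue_delta_term:
  assumes J: "J \<subseteq> {1..N}" and J': "J' \<subseteq> {1..N}" and c: "is_dist1 N c"
  shows "(mult_even ^^ j) (mult_odds (sorted_list_of_set J)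
      (dist_mult scale (divided_deriv_W m J' (super_delta N)) (as_dist_W c))) (- 1) {1..N} k K =
    (if j = m \<and> J = J' then c k K else 0)"
proof -
  let ?d = "divided_deriv_W m J' (super_delta N)" and ?xs = "sorted_list_of_set J"
  have hom: "homogeneous N (- 1 - int m) (int N - int (card J')) ?d"
    by (rule homogeneous_divided_deriv)
  have conv: "convolvable ?d (as_dist_W c)" by (rule convolvable_as_dist_W[OF hom])
  have "set ?xs \<subseteq> {1..N}" using J set_sorted_subset[OF J] by simp
  then have "(mult_even ^^ j) (mult_odds ?xs (dist_mult scale ?d (as_dist_W c))) =
      dist_mult scale ((mult_even ^^ j) (mult_odds ?xs ?d)) (as_dist_W c)"
    using dist_mult_mult_odds[OF homogeneous_is_dist2[OF hom] is_dist2_as_dist_W[OF c] conv]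
      dist_mult_mult_evens[OF convolvable_mult_odds[OF conv]] by simp
  moreover have "(mult_even ^^ j) (mult_odds ?xs ?d) (- 1) {1..N} k K =
      (if k = 0 \<and> K = {} then if j = m \<and> J = J' then 1 else 0 else 0)" for k K
    using residue_divided_deriv[OF J J', of j m k K] by simp
  ultimately show ?thesis
    using residue_dist_mult_as_dist_W[of "(mult_even ^^ j) (mult_odds ?xs ?d)" N _ c k K] by simp
qed

lemma mult_evens_delta_term:
  assumes "m < n"
  shows "(mult_even ^^ n) (dist_mult scale (divided_deriv_W m J (super_delta N)) (as_dist_W c)) = 0"
proof -
  have "convolvable (divided_deriv_W m J (super_delta N)) (as_dist_W c)"
    by (rule convolvable_as_dist_W[OF homogeneous_divided_deriv])
  then have "(mult_even ^^ n) (dist_mult scale (divided_deriv_W m J (super_delta N)) (as_dist_W c)) =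
      dist_mult scale 0 (as_dist_W c)"
    by (simp add: mult_evens_divided_deriv assms flip: dist_mult_mult_evens)
  also have "\<dots> = 0" by (intro ext) (simp add: dist_mult_def dist_apply)
  finally show ?thesis .
qed

text \<open>Orthogonality picks one term out of the finite sum. This serves three times: for the
  coefficient formula, for uniqueness, and in the existence proof for the candidate
  expansion.\<close>

lemma residue_delta_decomposition:
  assumes dec: "delta_decomposition scale N a c" and J: "J \<subseteq> {1..N}"
  shows "(mult_even ^^ j) (mult_odds (sorted_list_of_set J) a) (- 1) {1..N} = c j J"
proof (intro ext)
  fix k K
  let ?S = "{(j, J). c j J \<noteq> 0}"
  note dec' = dec[unfolded delta_decomposition_def]
  note c = dec'[THEN conjunct1] and out = dec'[THEN conjunct2, THEN conjunct1]
    and fin = dec'[THEN conjunct2, THEN conjunct2, THEN conjunct1]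
    and a = dec'[THEN conjunct2, THEN conjunct2, THEN conjunct2]
  have "(mult_even ^^ j) (mult_odds (sorted_list_of_set J) a) (- 1) {1..N} k K =
      (\<Sum>x\<in>?S. if x = (j, J) then c j J k K else 0)"
    unfolding a mult_odds_sum mult_evens_sum dist_sum_apply
  proof (rule sum.cong[OF refl])
    fix x assume x: "x \<in> ?S"
    obtain m J' where xe: "x = (m, J')" by (cases x)
    with x have "c m J' \<noteq> 0" by simp
    then have "J' \<subseteq> {1..N}" using out by metis
    from residue_delta_term[OF J this c[rule_format, of m J'], of j m k K]
    show "(mult_even ^^ j) (mult_odds (sorted_list_of_set J) (case x of (m, J') \<Rightarrow>
        dist_mult scale (divided_deriv_W m J' (super_delta N)) (as_dist_W (c m J')))) (- 1) {1..N} k K =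
        (if x = (j, J) then c j J k K else 0)"
      unfolding xe by auto
  qed
  also have "\<dots> = (if (j, J) \<in> ?S then c j J k K else 0)"
    using sum.delta[OF fin, of "(j, J)" "\<lambda>_. c j J k K"] by simp
  also have "\<dots> = c j J k K" by (auto simp: dist_apply)
  finally show "(mult_even ^^ j) (mult_odds (sorted_list_of_set J) a) (- 1) {1..N} k K = c j J k K" .
qed

lemma delta_decomposition_exists:
  assumes a: "is_dist2 N a" and loc: "(mult_even ^^ n) a = 0"
  shows "\<exists>c. delta_decomposition scale N a c"
proof -
  \<comment> \<open>The residues dictated by the coefficient formula, extended by 0 to index sets
    outside \<open>{1..N}\<close> as \<open>delta_decomposition\<close> prescribes.\<close>
  define c where "c j J = (if J \<subseteq> {1..N}
    then (mult_even ^^ j) (mult_odds (sorted_list_of_set J) a) (- 1) {1..N} else 0)" for j J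
  let ?S = "{(j, J). c j J \<noteq> 0}"
  define b where "b = (\<Sum>(m, J') \<in> ?S. dist_mult scale (divided_deriv_W m J' (super_delta N)) (as_dist_W (c m J')))"
  have dist1: "is_dist1 N (c j J)" for j J
  proof (cases "J \<subseteq> {1..N}")
    case True
    have "is_dist2 N ((mult_even ^^ j) (mult_odds (sorted_list_of_set J) a))"
      using a True set_sorted_subset[OF True] by (intro is_dist2_mult_evens is_dist2_mult_odds) simp_all
    from is_dist2D(2)[OF this, of "- 1" "{1..N}"] show ?thesis
      using True unfolding is_dist1_def by (simp add: c_def del: One_nat_def)
  next
    case False
    then show ?thesis by (simp add: c_def is_dist1_def dist_apply)
  qed
  have out: "c j J = 0" if "\<not> J \<subseteq> {1..N}" for j J
    using that by (simp add: c_def del: One_nat_def)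
  \<comment> \<open>Locality makes the expansion finite: powers of z - w from the n-th on annihilate
    \<open>a\<close>.\<close>
  have large: "c j J = 0" if "n \<le> j" for j J
  proof -
    have "(mult_even ^^ (j - n + n)) a = 0"
      by (simp only: funpow_add comp_apply loc mult_evens_0)
    then have "(mult_even ^^ j) a = 0" using that by simp
    then show ?thesis by (intro ext) (simp add: c_def mult_evens_odds mult_odds_0 dist_apply)
  qed
  have "?S \<subseteq> {..<n} \<times> Pow {1..N}"
  proof
    fix x assume x: "x \<in> ?S"
    obtain m J' where xe: "x = (m, J')" by (cases x)
    with x have nz: "c m J' \<noteq> 0" by simp
    then have "m < n" using large[of m J'] by (rule contrapos_np) simp
    moreover have "J' \<subseteq> {1..N}" using nz out by metis
    ultimately show "x \<in> {..<n} \<times> Pow {1..N}" by (simp add: xe)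
  qed
  then have fin: "finite ?S" by (rule finite_subset) simp
  have decb: "delta_decomposition scale N b c"
    unfolding delta_decomposition_def b_def using dist1 out fin by simp
  have "is_dist2 N b" unfolding b_def
    by (intro is_dist2_sum) (auto intro!: is_dist2_dist_mult is_dist2_as_dist_W dist1
        homogeneous_is_dist2[OF homogeneous_divided_deriv])
  then have ab: "is_dist2 N (a - b)"
    using a by (simp add: is_dist2_zero_iff dist_apply)
  \<comment> \<open>Only derivatives of order m < n in w occur in \<open>b\<close>, so the exponent
    n that works for \<open>a\<close> works for \<open>b\<close> too.\<close>
  have "(mult_even ^^ n) b = 0"
    unfolding b_def mult_evens_sum
  proof (intro sum.neutral ballI)
    fix x assume x: "x \<in> ?S"
    obtain m J' where xe: "x = (m, J')" by (cases x)
    with x have "c m J' \<noteq> 0" by simp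
    then have "m < n" using large[of m J'] by (rule contrapos_np) simp
    then show "(mult_even ^^ n) (case x of (m, J') \<Rightarrow>
        dist_mult scale (divided_deriv_W m J' (super_delta N)) (as_dist_W (c m J'))) = 0"
      by (simp add: xe mult_evens_delta_term)
  qed
  then have locab: "(mult_even ^^ n) (a - b) = 0"
    using mult_evens_add[of n "a - b" b] loc by simp
  have "(mult_even ^^ j) (mult_odds (sorted_list_of_set J) (a - b)) (- 1) {1..N} k K = 0"
    if J: "J \<subseteq> {1..N}" for j J k K
  proof -
    let ?R = "\<lambda>f. (mult_even ^^ j) (mult_odds (sorted_list_of_set J) f)"
    have "?R (a - b + b) = ?R (a - b) + ?R b"
      by (simp only: mult_odds_add mult_evens_add)
    then have "?R a (- 1) {1..N} k K = (?R (a - b) + ?R b) (- 1) {1..N} k K"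
      by (simp only: diff_add_cancel)
    \<comment> \<open>\<open>c\<close> consists of the residues of \<open>a\<close> by definition
      and of those of \<open>b\<close> by orthogonality.\<close>
    moreover have "?R a (- 1) {1..N} = ?R b (- 1) {1..N}"
      unfolding residue_delta_decomposition[OF decb J] using J by (simp add: c_def)
    ultimately show ?thesis by (simp add: dist_apply)
  qed
  from residues_injective[OF ab locab this] have "a = b" by simp
  with decb show ?thesis by blast
qed

end

theorem lemma3p1p7:
  fixes scale :: "complex \<Rightarrow> 'u::ab_group_add \<Rightarrow> 'u"
    and U0 U1 :: "'u set"
    and N :: nat
    and a :: "'u dist2"
  assumes "vector_superspace scale U0 U1"
    and "is_dist2 N a"
    and "local_dist scale a"
  shows "(\<exists>!c. delta_decomposition scale N a c) \<and>
    (\<forall>c. delta_decomposition scale N a c \<longrightarrow>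
      (\<forall>j J. J \<subseteq> {1..N} \<longrightarrow> c j J = res_Z N (dist_mult scale (diff_power j J) a)))"
proof -
  interpret complex_vector_space scale
    using assms(1) by (simp add: vector_superspace_def complex_vector_space_def)
  obtain n where n: "(mult_even ^^ n) a = 0"
    using assms(3) unfolding local_dist_def dist_mult_even_diff_power by blast
  have res: "c j J = res_Z N (dist_mult scale (diff_power j J) a)"
    if "delta_decomposition scale N a c" "J \<subseteq> {1..N}" for c j J
    using residue_delta_decomposition[OF that]
    by (simp only: res_Z_def dist_mult_diff_power[OF assms(2) that(2)])
  have "c = c'" if "delta_decomposition scale N a c" "delta_decomposition scale N a c'" for c c'
  proof (intro ext)
    fix j J k K
    \<comment> \<open>Inside \<open>{1..N}\<close> both are the same residue of \<open>a\<close>;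
      outside, both vanish by the convention in \<open>delta_decomposition\<close>.\<close>
    have "c j J = c' j J"
    proof (cases "J \<subseteq> {1..N}")
      case True
      then show ?thesis using res that by simp
    next
      case False
      then show ?thesis using that unfolding delta_decomposition_def by simp
    qed
    then show "c j J k K = c' j J k K" by simp
  qed
  then show ?thesis
    using delta_decomposition_exists[OF assms(2) n] res by blast
qed

end
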